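(* Suppose that the preferred curvatures $\alpha^0,\beta^0$ and the preferred twist $\gamma^0$ are independent of time. Then any solution $(\boldsymbol{x}_h,\boldsymbol{y}_h,\boldsymbol{\kappa}_h,m_h,z_h,\gamma_h,p_h,\boldsymbol{e}^1_h,\boldsymbol{e}^2_h)$ of the semi-discrete problem (defined in the context) satisfies $$ \int_0^1 \bigl( \mathbb{K}\,\boldsymbol{x}_{h,t}\cdot\boldsymbol{x}_{h,t} + K^{\mathrm{rot}} m_h^2 \bigr)\,|\boldsymbol{x}_{h,u}| + \frac12\frac{\mathrm{d}}{\mathrm{d}t}\int_0^1 \Bigl( \bigl( A\bigl((\alpha_h-\alpha^0)^2+(\beta_h-\beta^0)^2\bigr)\bigr)_h + C(\gamma_h-\gamma^0)^2 \Bigr)|\boldsymbol{x}_{h,u}| + \int_0^1 \Bigl( \bigl(B(\alpha_{h,t}^2+\beta_{h,t}^2)\bigr)_h + D\gamma_{h,t}^2 \Bigr)|\boldsymbol{x}_{h,u}| = 0 , $$ where $\alpha_h,\beta_h$ are the components of $\boldsymbol{\kappa}_h$ in the discrete frame, as defined in the context.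
   Context: Subscripts $u$ and $t$ (after a comma, for discrete functions) denote partial derivatives in $u\in[0,1]$ and in time $t$. Integrals are with respect to $du$. $\mathbb{I}$ is the $3\times 3$ identity matrix and $(\boldsymbol a\otimes\boldsymbol b)_{ij}=a_ib_j$. Data: $0<T<\infty$; $\mathbb{K}$ is a strictly positive definite $3\times3$ matrix; $K^{\mathrm{rot}}>0$ is a scalar; $A=A(u)\ge A_0>0$, $B=B(u)\ge0$, $C=C(u)>C_0>0$, $D=D(u)\ge 0$ are material parameters, which may depend on $u$ but not on time; $\alpha^0,\beta^0,\gamma^0$ are given real-valued fields (in general functions of $u$ and $t$). Finite element spaces: let $0=u_1<u_2<\dots<u_N=1$, and $V_h=\{v\in C([0,1]): v|_{[u_i,u_{i+1}]}\text{ affine},\ i=1,\dots,N-1\}$, $Q_h=\{q\in L^2(0,1): q|_{[u_i,u_{i+1}]}\text{ constant},\ i=1,\dots,N-1\}$, $V_{h,0}=\{v\in V_h: v(0)=v(1)=0\}$. Mass lumping: $(f)_h:=I_h(f)$, where $I_h:C([0,1])\to V_h$ is Lagrange (nodal) interpolation; only the values of $f$ at the vertices $u_i$ enter. Tangents: for $\boldsymbol{x}_h\in V_h^3$, $\boldsymbol{\tau}_h=\boldsymbol{x}_{h,u}/|\boldsymbol{x}_{h,u}|\in Q_h^3$, and $\tilde{\boldsymbol{\tau}}_h\in V_h^3$ has vertex values $\tilde{\boldsymbol{\tau}}_h(u_i,\cdot)=\dfrac{\boldsymbol{\tau}_h(u_i^-,\cdot)+\boldsymbol{\tau}_h(u_i^+,\cdot)}{|\boldsymbol{\tau}_h(u_i^-,\cdot)+\boldsymbol{\tau}_h(u_i^+,\cdot)|}$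 for $i=1,\dots,N$, where $\boldsymbol{\tau}_h(u_i^\pm,\cdot)$ is $\boldsymbol{\tau}_h$ evaluated on the element to the right ($+$) or left ($-$) of $u_i$ (at the end points only the one existing adjacent element is used). Semi-discrete problem: given initial data $\boldsymbol{x}_h^0\in V_h^3$ and $\boldsymbol{e}_h^{1,0},\boldsymbol{e}_h^{2,0}\in V_h^3$ such that at each vertex $\tilde{\boldsymbol\tau}_h(\cdot,0),\boldsymbol{e}_h^{1,0},\boldsymbol{e}_h^{2,0}$ (with $\tilde{\boldsymbol\tau}_h(\cdot,0)$ built from $\boldsymbol{x}^0_h$) are orthonormal, find, for $t\in[0,T)$, functions $\boldsymbol{x}_h(\cdot,t)\in V_h^3$, $\boldsymbol{y}_h(\cdot,t)\in V_{h,0}^3$, $\boldsymbol{\kappa}_h(\cdot,t)\in V_h^3$ with $\boldsymbol{\kappa}_h=\alpha^0\boldsymbol{e}^1_h+\beta^0\boldsymbol{e}^2_h$ at $u=0$ and $u=1$, $m_h(\cdot,t)\in V_h$, $z_h(\cdot,t),\gamma_h(\cdot,t),p_h(\cdot,t)\in Q_h$, $\boldsymbol{e}^1_h(\cdot,t),\boldsymbol{e}^2_h(\cdot,t)\in V_h^3$, such that for all $t\in(0,T)$ and all $\boldsymbol{\phi}_h\in V_h^3$, $\boldsymbol{\psi}_h\in V_{h,0}^3$, $v_h\in V_h$, $q_h\in Q_h$: (1) $\int_0^1\mathbb{K}\boldsymbol{x}_{h,t}\cdot\boldsymbol{\phi}_h|\boldsymbol{x}_{h,u}|-\int_0^1p_h\boldsymbol{\tau}_h\cdot\boldsymbol{\phi}_{h,u}-\int_0^1\bigl((\mathbb{I}-\boldsymbol{\tau}_h\otimes\boldsymbol{\tau}_h)\frac{\boldsymbol{y}_{h,u}}{|\boldsymbol{x}_{h,u}|}+z_h\boldsymbol{\tau}_h\times\boldsymbol{\kappa}_h\bigr)\cdot\boldsymbol{\phi}_{h,u}=0$;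 (2) $\int_0^1\Bigl(\bigl(\boldsymbol{y}_h-A(\boldsymbol{\kappa}_h-\alpha^0\boldsymbol{e}^1_h-\beta^0\boldsymbol{e}^2_h)-B((\mathbb{I}-\tilde{\boldsymbol{\tau}}_h\otimes\tilde{\boldsymbol{\tau}}_h)\boldsymbol{\kappa}_{h,t}-m_h\tilde{\boldsymbol{\tau}}_h\times\boldsymbol{\kappa}_h)\bigr)\cdot\boldsymbol{\psi}_h\Bigr)_h|\boldsymbol{x}_{h,u}|=0$; (3) $\int_0^1(\boldsymbol{\kappa}_h\cdot\boldsymbol{\psi}_h)_h|\boldsymbol{x}_{h,u}|+\frac{\boldsymbol{x}_{h,u}}{|\boldsymbol{x}_{h,u}|}\cdot\boldsymbol{\psi}_{h,u}=0$; (4) $-\int_0^1(K^{\mathrm{rot}}m_hv_h)_h|\boldsymbol{x}_{h,u}|-\int_0^1z_hv_{h,u}+\int_0^1(\boldsymbol{y}_h\cdot(\tilde{\boldsymbol{\tau}}_h\times\boldsymbol{\kappa}_h)v_h)_h|\boldsymbol{x}_{h,u}|=0$; (5) $\int_0^1(z_h-C(\gamma_h-\gamma^0)-D\gamma_{h,t})q_h|\boldsymbol{x}_{h,u}|=0$; (6) $\int_0^1\gamma_{h,t}q_h|\boldsymbol{x}_{h,u}|-\int_0^1m_{h,u}q_h+\int_0^1(\boldsymbol{\tau}_h\times\boldsymbol{\kappa}_h)\cdot\boldsymbol{x}_{h,tu}\,q_h=0$; (7) $\int_0^1q_h\boldsymbol{\tau}_h\cdot\boldsymbol{x}_{h,tu}=0$;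 (8) for $j=1,2$: $\int_0^1\Bigl(\bigl(\boldsymbol{e}^j_{h,t}-(\tilde{\boldsymbol{\tau}}_h\times\tilde{\boldsymbol{\tau}}_{h,t}+m_h\tilde{\boldsymbol{\tau}}_h)\times\boldsymbol{e}^j_h\bigr)\cdot\boldsymbol{\phi}_h\Bigr)_h|\boldsymbol{x}_{h,u}|=0$; together with the initial conditions $\boldsymbol{x}_h(\cdot,0)=\boldsymbol{x}_h^0$, $\boldsymbol{e}^1_h(\cdot,0)=\boldsymbol{e}^{1,0}_h$, $\boldsymbol{e}^2_h(\cdot,0)=\boldsymbol{e}^{2,0}_h$ and the initial equations $\int_0^1\boldsymbol{\kappa}_h(\cdot,0)\cdot\boldsymbol{\psi}_h|\boldsymbol{x}^0_{h,u}|+\frac{\boldsymbol{x}^0_{h,u}}{|\boldsymbol{x}^0_{h,u}|}\cdot\boldsymbol{\psi}_{h,u}=0$ for all $\boldsymbol{\psi}_h\in V_{h,0}^3$ and $\int_0^1\bigl(\gamma_h(\cdot,0)-\frac{\boldsymbol{e}^{1,0}_{h,u}}{|\boldsymbol{x}^0_{h,u}|}\cdot\boldsymbol{e}^{2,0}_h\bigr)v_h|\boldsymbol{x}^0_{h,u}|=0$ for all $v_h\in V_h$. Components of the curvature: for a solution, $\boldsymbol{\kappa}_h$ is orthogonal to $\tilde{\boldsymbol{\tau}}_h$ at every vertex and $(\tilde{\boldsymbol{\tau}}_h,\boldsymbol{e}^1_h,\boldsymbol{e}^2_h)$ is orthonormal at every vertex; $\alpha_h,\beta_h\in V_h$ are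 the functions with $\boldsymbol{\kappa}_h(u_i,\cdot)=\alpha_h(u_i,\cdot)\boldsymbol{e}^1_h(u_i,\cdot)+\beta_h(u_i,\cdot)\boldsymbol{e}^2_h(u_i,\cdot)$ for $i=1,\dots,N$.
   Formalization: The term K^rot m_h^2 in the first integral is mass lumped, (K^rot m_h^2)_h, as in equation (4); with the exact integral the identity fails, e.g. for a straight stationary rod on one element with relaxing twist. *)

theory Defs
  imports "HOL-Analysis.Analysis"
begin

unbundle cross3_syntax

text \<open>
  Fields on the rod are functions of time first and of the arclength-like parameter
  second, so that \<open>f t\<close> is the spatial profile of \<open>f\<close> at time \<open>t\<close>.
  Only their values for parameters in \<open>{0..1}\<close> matter.
\<close>

definition du :: "(real \<Rightarrow> 'a::real_normed_vector) \<Rightarrow> real \<Rightarrow> 'a" where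
  "du f s = vector_derivative f (at s)"

definition dt :: "(real \<Rightarrow> real \<Rightarrow> 'a::real_normed_vector) \<Rightarrow> real \<Rightarrow> real \<Rightarrow> 'a" where
  "dt f t s = vector_derivative (\<lambda>r. f r s) (at t)"

definition outer :: "real^3 \<Rightarrow> real^3 \<Rightarrow> real^3^3" (infixl "\<otimes>" 75) where
  "a \<otimes> b = (\<chi> i j. a $ i * b $ j)"

definition pos_def :: "real^3^3 \<Rightarrow> bool" where
  "pos_def K \<longleftrightarrow> (\<forall>v. v \<noteq> 0 \<longrightarrow> (K *v v) \<bullet> v > 0)"

definition orthonormal3 :: "real^3 \<Rightarrow> real^3 \<Rightarrow> real^3 \<Rightarrow> bool" where
  "orthonormal3 a b c \<longleftrightarrow>
     norm a = 1 \<and> norm b = 1 \<and> norm c = 1 \<and> a \<bullet> b = 0 \<and> a \<bullet> c = 0 \<and> b \<bullet> c = 0"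


section \<open>Finite element spaces and mass lumping\<close>

text \<open>The vertices are \<open>w 1, \<dots>, w N\<close>; other values of \<open>w\<close> are irrelevant.\<close>

definition is_mesh :: "nat \<Rightarrow> (nat \<Rightarrow> real) \<Rightarrow> bool" where
  "is_mesh N w \<longleftrightarrow> N \<ge> 2 \<and> w 1 = 0 \<and> w N = 1 \<and> (\<forall>i\<in>{1..<N}. w i < w (Suc i))"

text \<open>For \<open>'a = real^3\<close> the following are the spaces of vector fields whose three
  components lie in the scalar space.\<close>

definition Vh :: "nat \<Rightarrow> (nat \<Rightarrow> real) \<Rightarrow> (real \<Rightarrow> 'a::real_normed_vector) set" where
  "Vh N w = {v. continuous_on {0..1} v \<and>
     (\<forall>i\<in>{1..<N}. \<exists>a b. \<forall>s\<in>{w i..w (Suc i)}. v s = a + s *\<^sub>R b)}"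

definition Vh0 :: "nat \<Rightarrow> (nat \<Rightarrow> real) \<Rightarrow> (real \<Rightarrow> 'a::real_normed_vector) set" where
  "Vh0 N w = {v \<in> Vh N w. v 0 = 0 \<and> v 1 = 0}"

text \<open>Elements of the discontinuous space are represented by functions that are constant on
  the open elements; their values at the vertices form a null set and are left arbitrary.\<close>

definition Qh :: "nat \<Rightarrow> (nat \<Rightarrow> real) \<Rightarrow> (real \<Rightarrow> real) set" where
  "Qh N w = {q. \<forall>i\<in>{1..<N}. q constant_on {w i<..<w (Suc i)}}"

text \<open>Nodal interpolation: on the element \<open>{w i..w (Suc i)}\<close> containing \<open>s\<close>, the affine
  interpolant of the two vertex values.\<close>

definition interp ::
  "nat \<Rightarrow> (nat \<Rightarrow> real) \<Rightarrow> (real \<Rightarrow> 'a::real_normed_vector) \<Rightarrow> real \<Rightarrow> 'a" where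
  "interp N w f s =
     (let i = Max {i \<in> {1..<N}. w i \<le> s}
      in f (w i) + ((s - w i) / (w (Suc i) - w i)) *\<^sub>R (f (w (Suc i)) - f (w i)))"

lemma mesh_less:
  assumes "is_mesh N w" "1 \<le> i" "i < j" "j \<le> N"
  shows "w i < w j"
  using assms(3,4)
proof (induction j)
  case (Suc j)
  have step: "w j < w (Suc j)" using assms(1,2) Suc.prems by (auto simp: is_mesh_def)
  show ?case
  proof (cases "i = j")
    case False
    then show ?thesis using Suc step by fastforce
  qed (use step in simp)
qed simp

lemma interp_on_element:
  assumes m: "is_mesh N w" and i: "i \<in> {1..<N}" and s: "s \<in> {w i..w (Suc i)}"
  shows "interp N w f s =
    f (w i) + ((s - w i) / (w (Suc i) - w i)) *\<^sub>R (f (w (Suc i)) - f (w i))"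
proof -
  let ?J = "{j \<in> {1..<N}. w j \<le> s}"
  have mono: "w a < w b" if "1 \<le> a" "a < b" "b \<le> N" for a b
    using mesh_less[OF m that] .
  have fin: "finite ?J" by simp
  show ?thesis
  proof (cases "s < w (Suc i) \<or> Suc i = N")
    case True
    have "Max ?J = i"
    proof (rule Max_eqI[OF fin])
      fix j assume j: "j \<in> ?J"
      show "j \<le> i"
      proof (rule ccontr)
        assume "\<not> j \<le> i"
        then have "Suc i \<le> j" "Suc i < N" using j by auto
        moreover from this have "w (Suc i) \<le> w j"
          using mono[of "Suc i" j] j by (cases "Suc i = j") auto
        ultimately show False using True j by auto
      qed
    qed (use i s in auto)
    then show ?thesis by (simp add: interp_def)
  next
    case False
    then have s_eq: "s = w (Suc i)" and iN: "Suc i < N" using s i by auto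
    have "Max ?J = Suc i"
    proof (rule Max_eqI[OF fin])
      fix j assume j: "j \<in> ?J"
      show "j \<le> Suc i"
        using mono[of "Suc i" j] j s_eq by (cases "Suc i < j") auto
    qed (use iN s_eq in auto)
    moreover have "w i < w (Suc i)" using mono[of i "Suc i"] i by auto
    ultimately show ?thesis by (simp add: interp_def s_eq)
  qed
qed

lemma interp_vertex:
  assumes m: "is_mesh N w" and i: "i \<in> {1..N}"
  shows "interp N w f (w i) = f (w i)"
proof (cases "i = N")
  case True
  obtain k where k: "N = Suc k" "k \<in> {1..<N}"
    using m by (cases N) (auto simp: is_mesh_def)
  have "w k < w N" using mesh_less[OF m, of k N] k by auto
  then show ?thesis using interp_on_element[OF m k(2), of "w N" f] True k by auto
next
  case False
  then have i': "i \<in> {1..<N}" using i by auto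
  then have "w i < w (Suc i)" using mesh_less[OF m, of i "Suc i"] by auto
  then show ?thesis using interp_on_element[OF m i', of "w i" f] by auto
qed


section \<open>Tangents\<close>

definition tangent :: "(real \<Rightarrow> real^3) \<Rightarrow> real \<Rightarrow> real^3" where
  "tangent X s = du X s /\<^sub>R norm (du X s)"

text \<open>For \<open>X\<close> in \<open>Vh N w\<close> the tangent is constant on each open element, so the one-sided
  limits are its values on the elements adjacent to \<open>s\<close>.\<close>

definition tangent_left :: "(real \<Rightarrow> real^3) \<Rightarrow> real \<Rightarrow> real^3" where
  "tangent_left X s = (if s = 0 then 0 else Lim (at_left s) (tangent X))"

definition tangent_right :: "(real \<Rightarrow> real^3) \<Rightarrow> real \<Rightarrow> real^3" where
  "tangent_right X s = (if s = 1 then 0 else Lim (at_right s) (tangent X))"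

definition vertex_tangent ::
  "nat \<Rightarrow> (nat \<Rightarrow> real) \<Rightarrow> (real \<Rightarrow> real^3) \<Rightarrow> real \<Rightarrow> real^3" where
  "vertex_tangent N w X =
     interp N w (\<lambda>s. (tangent_left X s + tangent_right X s) /\<^sub>R
                     norm (tangent_left X s + tangent_right X s))"

text \<open>All quotients above have nonzero denominators.\<close>

definition regular_curve :: "nat \<Rightarrow> (nat \<Rightarrow> real) \<Rightarrow> (real \<Rightarrow> real^3) \<Rightarrow> bool" where
  "regular_curve N w X \<longleftrightarrow>
     (\<forall>i\<in>{1..<N}. \<forall>s\<in>{w i<..<w (Suc i)}. du X s \<noteq> 0) \<and>
     (\<forall>i\<in>{1..N}. tangent_left X (w i) + tangent_right X (w i) \<noteq> 0)"


section \<open>The semi-discrete problem\<close>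

definition initial_data ::
  "nat \<Rightarrow> (nat \<Rightarrow> real) \<Rightarrow> (real \<Rightarrow> real^3) \<Rightarrow> (real \<Rightarrow> real^3) \<Rightarrow> (real \<Rightarrow> real^3) \<Rightarrow> bool" where
  "initial_data N w x0 e10 e20 \<longleftrightarrow>
     x0 \<in> Vh N w \<and> e10 \<in> Vh N w \<and> e20 \<in> Vh N w \<and> regular_curve N w x0 \<and>
     (\<forall>i\<in>{1..N}. orthonormal3 (vertex_tangent N w x0 (w i)) (e10 (w i)) (e20 (w i)))"

text \<open>Time regularity: the fields with prescribed initial values are continuous on
  \<open>{0..<T}\<close>, and every field whose time derivative occurs in the equations is
  differentiable on \<open>{0<..<T}\<close>. Nothing is required of the time dependence of the others.\<close>

definition fields_ok ::
  "nat \<Rightarrow> (nat \<Rightarrow> real) \<Rightarrow> real \<Rightarrow>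
   (real \<Rightarrow> real \<Rightarrow> real) \<Rightarrow> (real \<Rightarrow> real \<Rightarrow> real) \<Rightarrow>
   (real \<Rightarrow> real \<Rightarrow> real^3) \<Rightarrow> (real \<Rightarrow> real \<Rightarrow> real^3) \<Rightarrow> (real \<Rightarrow> real \<Rightarrow> real^3) \<Rightarrow>
   (real \<Rightarrow> real \<Rightarrow> real) \<Rightarrow> (real \<Rightarrow> real \<Rightarrow> real) \<Rightarrow> (real \<Rightarrow> real \<Rightarrow> real) \<Rightarrow> (real \<Rightarrow> real \<Rightarrow> real) \<Rightarrow>
   (real \<Rightarrow> real \<Rightarrow> real^3) \<Rightarrow> (real \<Rightarrow> real \<Rightarrow> real^3) \<Rightarrow> bool" where
  "fields_ok N w T \<alpha>0 \<beta>0 x y \<kappa> m z \<gamma> p e1 e2 \<longleftrightarrow>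
     (\<forall>t\<in>{0..<T}.
        x t \<in> Vh N w \<and> y t \<in> Vh0 N w \<and> \<kappa> t \<in> Vh N w \<and> m t \<in> Vh N w \<and>
        z t \<in> Qh N w \<and> \<gamma> t \<in> Qh N w \<and> p t \<in> Qh N w \<and>
        e1 t \<in> Vh N w \<and> e2 t \<in> Vh N w \<and>
        (\<forall>s\<in>{0, 1}. \<kappa> t s = \<alpha>0 t s *\<^sub>R e1 t s + \<beta>0 t s *\<^sub>R e2 t s) \<and>
        regular_curve N w (x t)) \<and>
     (\<forall>s\<in>{0..1}. continuous_on {0..<T} (\<lambda>t. x t s) \<and>
        continuous_on {0..<T} (\<lambda>t. e1 t s) \<and> continuous_on {0..<T} (\<lambda>t. e2 t s)) \<and>
     (\<forall>t\<in>{0<..<T}. \<forall>s\<in>{0..1}.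
        (\<lambda>r. x r s) differentiable at t \<and> (\<lambda>r. \<kappa> r s) differentiable at t \<and>
        (\<lambda>r. e1 r s) differentiable at t \<and> (\<lambda>r. e2 r s) differentiable at t) \<and>
     (\<forall>t\<in>{0<..<T}. \<forall>i\<in>{1..<N}. \<forall>s\<in>{w i<..<w (Suc i)}. (\<lambda>r. \<gamma> r s) differentiable at t)"

definition semidiscrete_equations ::
  "nat \<Rightarrow> (nat \<Rightarrow> real) \<Rightarrow> real^3^3 \<Rightarrow> real \<Rightarrow>
   (real \<Rightarrow> real) \<Rightarrow> (real \<Rightarrow> real) \<Rightarrow> (real \<Rightarrow> real) \<Rightarrow> (real \<Rightarrow> real) \<Rightarrow>
   (real \<Rightarrow> real \<Rightarrow> real) \<Rightarrow> (real \<Rightarrow> real \<Rightarrow> real) \<Rightarrow> (real \<Rightarrow> real \<Rightarrow> real) \<Rightarrow>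
   (real \<Rightarrow> real \<Rightarrow> real^3) \<Rightarrow> (real \<Rightarrow> real \<Rightarrow> real^3) \<Rightarrow> (real \<Rightarrow> real \<Rightarrow> real^3) \<Rightarrow>
   (real \<Rightarrow> real \<Rightarrow> real) \<Rightarrow> (real \<Rightarrow> real \<Rightarrow> real) \<Rightarrow> (real \<Rightarrow> real \<Rightarrow> real) \<Rightarrow> (real \<Rightarrow> real \<Rightarrow> real) \<Rightarrow>
   (real \<Rightarrow> real \<Rightarrow> real^3) \<Rightarrow> (real \<Rightarrow> real \<Rightarrow> real^3) \<Rightarrow> real \<Rightarrow> bool" where
  "semidiscrete_equations N w K Krot A B C D \<alpha>0 \<beta>0 \<gamma>0 x y \<kappa> m z \<gamma> p e1 e2 t \<longleftrightarrow>
    (let speed = (\<lambda>s. norm (du (x t) s));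
         \<tau> = tangent (x t);
         \<tau>v = vertex_tangent N w (x t);
         \<tau>v_t = dt (\<lambda>r. vertex_tangent N w (x r)) t;
         x_tu = du (dt x t)
     in
      (\<forall>\<phi>\<in>Vh N w.
         integral {0..1} (\<lambda>s. ((K *v dt x t s) \<bullet> \<phi> s) * speed s)
         - integral {0..1} (\<lambda>s. p t s * (\<tau> s \<bullet> du \<phi> s))
         - integral {0..1} (\<lambda>s.
             ((mat 1 - \<tau> s \<otimes> \<tau> s) *v (du (y t) s /\<^sub>R speed s) + z t s *\<^sub>R (\<tau> s \<times> \<kappa> t s)) \<bullet> du \<phi> s)
         = 0) \<and>
      (\<forall>\<psi>\<in>Vh0 N w.
         integral {0..1} (\<lambda>u. interp N w (\<lambda>s.
             (y t s - A s *\<^sub>R (\<kappa> t s - \<alpha>0 t s *\<^sub>R e1 t s - \<beta>0 t s *\<^sub>R e2 t s)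
              - B s *\<^sub>R ((mat 1 - \<tau>v s \<otimes> \<tau>v s) *v dt \<kappa> t s - m t s *\<^sub>R (\<tau>v s \<times> \<kappa> t s))) \<bullet> \<psi> s) u
           * speed u) = 0) \<and>
      (\<forall>\<psi>\<in>Vh0 N w.
         integral {0..1} (\<lambda>u. interp N w (\<lambda>s. \<kappa> t s \<bullet> \<psi> s) u * speed u
           + (du (x t) u /\<^sub>R speed u) \<bullet> du \<psi> u) = 0) \<and>
      (\<forall>v\<in>Vh N w.
         - integral {0..1} (\<lambda>u. interp N w (\<lambda>s. Krot * m t s * v s) u * speed u)
         - integral {0..1} (\<lambda>u. z t u * du v u)
         + integral {0..1} (\<lambda>u. interp N w (\<lambda>s. (y t s \<bullet> (\<tau>v s \<times> \<kappa> t s)) * v s) u * speed u)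
         = 0) \<and>
      (\<forall>q\<in>Qh N w.
         integral {0..1} (\<lambda>s. (z t s - C s * (\<gamma> t s - \<gamma>0 t s) - D s * dt \<gamma> t s) * q s * speed s) = 0) \<and>
      (\<forall>q\<in>Qh N w.
         integral {0..1} (\<lambda>s. dt \<gamma> t s * q s * speed s)
         - integral {0..1} (\<lambda>s. du (m t) s * q s)
         + integral {0..1} (\<lambda>s. ((\<tau> s \<times> \<kappa> t s) \<bullet> x_tu s) * q s) = 0) \<and>
      (\<forall>q\<in>Qh N w. integral {0..1} (\<lambda>s. q s * (\<tau> s \<bullet> x_tu s)) = 0) \<and>
      (\<forall>e\<in>{e1, e2}. \<forall>\<phi>\<in>Vh N w.
         integral {0..1} (\<lambda>u. interp N w (\<lambda>s.
             (dt e t s - (\<tau>v s \<times> \<tau>v_t s + m t s *\<^sub>R \<tau>v s) \<times> e t s) \<bullet> \<phi> s) u * speed u) = 0))"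

definition initial_equations ::
  "nat \<Rightarrow> (nat \<Rightarrow> real) \<Rightarrow> (real \<Rightarrow> real^3) \<Rightarrow> (real \<Rightarrow> real^3) \<Rightarrow> (real \<Rightarrow> real^3) \<Rightarrow>
   (real \<Rightarrow> real \<Rightarrow> real^3) \<Rightarrow> (real \<Rightarrow> real \<Rightarrow> real^3) \<Rightarrow> (real \<Rightarrow> real \<Rightarrow> real) \<Rightarrow>
   (real \<Rightarrow> real \<Rightarrow> real^3) \<Rightarrow> (real \<Rightarrow> real \<Rightarrow> real^3) \<Rightarrow> bool" where
  "initial_equations N w x0 e10 e20 x \<kappa> \<gamma> e1 e2 \<longleftrightarrow>
     (\<forall>s\<in>{0..1}. x 0 s = x0 s \<and> e1 0 s = e10 s \<and> e2 0 s = e20 s) \<and>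
     (\<forall>\<psi>\<in>Vh0 N w.
        integral {0..1} (\<lambda>s. (\<kappa> 0 s \<bullet> \<psi> s) * norm (du x0 s)
          + (du x0 s /\<^sub>R norm (du x0 s)) \<bullet> du \<psi> s) = 0) \<and>
     (\<forall>v\<in>Vh N w.
        integral {0..1} (\<lambda>s. (\<gamma> 0 s - (du e10 s /\<^sub>R norm (du x0 s)) \<bullet> e20 s) * v s * norm (du x0 s)) = 0)"

definition semidiscrete_solution ::
  "nat \<Rightarrow> (nat \<Rightarrow> real) \<Rightarrow> real \<Rightarrow> real^3^3 \<Rightarrow> real \<Rightarrow>
   (real \<Rightarrow> real) \<Rightarrow> (real \<Rightarrow> real) \<Rightarrow> (real \<Rightarrow> real) \<Rightarrow> (real \<Rightarrow> real) \<Rightarrow>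
   (real \<Rightarrow> real \<Rightarrow> real) \<Rightarrow> (real \<Rightarrow> real \<Rightarrow> real) \<Rightarrow> (real \<Rightarrow> real \<Rightarrow> real) \<Rightarrow>
   (real \<Rightarrow> real^3) \<Rightarrow> (real \<Rightarrow> real^3) \<Rightarrow> (real \<Rightarrow> real^3) \<Rightarrow>
   (real \<Rightarrow> real \<Rightarrow> real^3) \<Rightarrow> (real \<Rightarrow> real \<Rightarrow> real^3) \<Rightarrow> (real \<Rightarrow> real \<Rightarrow> real^3) \<Rightarrow>
   (real \<Rightarrow> real \<Rightarrow> real) \<Rightarrow> (real \<Rightarrow> real \<Rightarrow> real) \<Rightarrow> (real \<Rightarrow> real \<Rightarrow> real) \<Rightarrow> (real \<Rightarrow> real \<Rightarrow> real) \<Rightarrow>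
   (real \<Rightarrow> real \<Rightarrow> real^3) \<Rightarrow> (real \<Rightarrow> real \<Rightarrow> real^3) \<Rightarrow> bool" where
  "semidiscrete_solution N w T K Krot A B C D \<alpha>0 \<beta>0 \<gamma>0 x0 e10 e20 x y \<kappa> m z \<gamma> p e1 e2 \<longleftrightarrow>
     initial_data N w x0 e10 e20 \<and>
     fields_ok N w T \<alpha>0 \<beta>0 x y \<kappa> m z \<gamma> p e1 e2 \<and>
     (\<forall>t\<in>{0<..<T}.
        semidiscrete_equations N w K Krot A B C D \<alpha>0 \<beta>0 \<gamma>0 x y \<kappa> m z \<gamma> p e1 e2 t) \<and>
     initial_equations N w x0 e10 e20 x \<kappa> \<gamma> e1 e2"

text \<open>Existence of the components follows from the orthonormality of the discrete frame and
  the orthogonality of the curvature to the vertex tangent, which hold for \<open>0 < t < T\<close>. At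
  \<open>t = 0\<close> the curvature solves an equation without mass lumping and may have a tangential
  part, so the initial time is excluded.\<close>

definition curvature_components ::
  "nat \<Rightarrow> (nat \<Rightarrow> real) \<Rightarrow> real \<Rightarrow> (real \<Rightarrow> real \<Rightarrow> real^3) \<Rightarrow>
   (real \<Rightarrow> real \<Rightarrow> real^3) \<Rightarrow> (real \<Rightarrow> real \<Rightarrow> real^3) \<Rightarrow>
   (real \<Rightarrow> real \<Rightarrow> real) \<Rightarrow> (real \<Rightarrow> real \<Rightarrow> real) \<Rightarrow> bool" where
  "curvature_components N w T \<kappa> e1 e2 \<alpha> \<beta> \<longleftrightarrow>
     (\<forall>t\<in>{0<..<T}. \<alpha> t \<in> Vh N w \<and> \<beta> t \<in> Vh N w \<and>
        (\<forall>i\<in>{1..N}. \<kappa> t (w i) = \<alpha> t (w i) *\<^sub>R e1 t (w i) + \<beta> t (w i) *\<^sub>R e2 t (w i)))"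


section \<open>The energy\<close>

text \<open>
  In the energy identity the rotational dissipation is the lumped integral
  \<open>integral {0..1} (\<lambda>u. interp N w (\<lambda>s. Krot * (m t s)\<^sup>2) u * norm (du (x t) u))\<close>, because the
  moment balance, tested with \<open>m t\<close>, produces exactly this term. With the exact integral of
  \<open>Krot * (m t u)\<^sup>2\<close> the identity is false: take \<open>N = 2\<close>, the stationary straight rod
  \<open>x t s = s *\<^sub>R a\<close> with \<open>norm a = 1\<close>, \<open>y = \<kappa> = 0\<close>, \<open>p = 0\<close>, \<open>\<alpha>0 = \<beta>0 = 0\<close>, \<open>\<gamma>0 = 1\<close>,
  \<open>C\<close> constant, \<open>D = 0\<close>, \<open>\<gamma> t = 1 - exp (- 4 * C * t / Krot)\<close>, \<open>z t = C * (\<gamma> t - 1)\<close>,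
  \<open>m t s = 2 * z t / Krot * (1 - 2 * s)\<close> and frame vectors that rotate about \<open>a\<close> with angular
  velocity \<open>m\<close> at the two vertices, starting from a constant frame. The time derivative of
  the energy contributes \<open>- 4 * (z t)\<^sup>2 / Krot\<close>, which is balanced by the lumped term
  \<open>4 * (z t)\<^sup>2 / Krot\<close> but not by the exact one, \<open>4 / 3 * (z t)\<^sup>2 / Krot\<close>.
\<close>

definition energy ::
  "nat \<Rightarrow> (nat \<Rightarrow> real) \<Rightarrow> (real \<Rightarrow> real) \<Rightarrow> (real \<Rightarrow> real) \<Rightarrow>
   (real \<Rightarrow> real \<Rightarrow> real) \<Rightarrow> (real \<Rightarrow> real \<Rightarrow> real) \<Rightarrow> (real \<Rightarrow> real \<Rightarrow> real) \<Rightarrow>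
   (real \<Rightarrow> real \<Rightarrow> real^3) \<Rightarrow> (real \<Rightarrow> real \<Rightarrow> real) \<Rightarrow> (real \<Rightarrow> real \<Rightarrow> real) \<Rightarrow> (real \<Rightarrow> real \<Rightarrow> real) \<Rightarrow>
   real \<Rightarrow> real" where
  "energy N w A C \<alpha>0 \<beta>0 \<gamma>0 x \<alpha> \<beta> \<gamma> t =
     integral {0..1} (\<lambda>u.
       (interp N w (\<lambda>s. A s * ((\<alpha> t s - \<alpha>0 t s)\<^sup>2 + (\<beta> t s - \<beta>0 t s)\<^sup>2)) u
        + C u * (\<gamma> t u - \<gamma>0 t u)\<^sup>2) * norm (du (x t) u))"

end

theory Submission
  imports Defs
begin

text \<open>
  The identity is the power balance of the rod: each equation is tested with the rate conjugate to
  it, so that all exchange terms cancel and only dissipation and the rate of the stored energy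
  remain. Everything reduces to finitely many numbers, because a continuous piecewise affine field
  is determined by its vertex values, its derivative on an element is the increment over that
  element (\<open>edge\<close>) divided by the length, and a lumped integral against the speed is a weighted
  sum of vertex values (\<open>lump\<close>).

  The constraint that the tangential part of \<open>x\<^sub>t\<^sub>u\<close> vanishes keeps the length of every element
  constant in time (\<open>inextensible_edges\<close>), so the weights of all lumped sums may be treated as
  constants when differentiating. The constitutive law for the bending moment \<open>y\<close> and the evolution
  equations of the frame are lumped and hence hold vertex by vertex (\<open>lump_spike_eq_0\<close>). By the
  latter, the vertex tangent and both frame vectors are carried by one and the same angular velocity,
  so an initially orthonormal frame stays orthonormal (\<open>frame_orthonormal\<close>). This makes the
  components of the curvature at the vertices its inner products with the frame vectors, hence
  differentiable in time.

  The momentum equation is tested with the velocity, where the pressure drops out by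
  inextensibility (\<open>momentum_power\<close>). The remaining bending term pairs the rate of the unit tangent
  with the derivative of \<open>y\<close> along the rod; the time derivative of the curvature equation, tested
  with \<open>y\<close>, turns it into minus the lumped integral of the rate of \<open>\<kappa>\<close> against \<open>y\<close>
  (\<open>curvature_rate\<close>). The remaining term with \<open>z\<close> is eliminated by the kinematic equation of the twist
  tested with \<open>z\<close>, the equation for \<open>m\<close> tested with \<open>m\<close>, and the constitutive law of the twist tested
  with the rate of \<open>\<gamma>\<close> (\<open>twist_power\<close>). What is left of the bending terms is the power of \<open>y\<close> on the
  rate of \<open>\<kappa>\<close> minus \<open>m\<close> times the cross product of vertex tangent and \<open>\<kappa>\<close>. At interior vertices the
  constitutive law turns it into the elastic and viscous bending power (\<open>curvature_power\<close>); at the two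
  ends \<open>y\<close> vanishes, and so do both powers, since there \<open>\<alpha>\<close> and \<open>\<beta>\<close> equal the time-independent
  preferred curvatures.
\<close>


section \<open>Meshes and elementwise integration\<close>

lemma mesh_step: "is_mesh N w \<Longrightarrow> i \<in> {1..<N} \<Longrightarrow> w i < w (Suc i)"
  by (simp add: is_mesh_def)

lemma mesh_le:
  assumes "is_mesh N w" "1 \<le> i" "i \<le> j" "j \<le> N"
  shows "w i \<le> w j"
  using mesh_less[OF assms(1,2), of j] assms(3,4) by (cases "i = j") auto

lemma mesh_vertex_in:
  assumes "is_mesh N w" "i \<in> {1..N}"
  shows "w i \<in> {0..1}"
  using mesh_le[OF assms(1), of 1 i] mesh_le[OF assms(1), of i N] assms
  by (auto simp: is_mesh_def)

lemma mesh_element_subset: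
  assumes "is_mesh N w" "i \<in> {1..<N}"
  shows "{w i..w (Suc i)} \<subseteq> {0..1}"
  using mesh_vertex_in[OF assms(1), of i] mesh_vertex_in[OF assms(1), of "Suc i"] assms(2) by auto

lemma mesh_cover:
  assumes m: "is_mesh N w" and s: "s \<in> {0..1}"
  obtains i where "i \<in> {1..<N}" "s \<in> {w i..w (Suc i)}"
proof -
  have "s \<in> {w 1..w n} \<longrightarrow> (\<exists>i\<in>{1..<n}. s \<in> {w i..w (Suc i)})" if "2 \<le> n" for n
    using that
  proof (induction n rule: dec_induct)
    case base
    show ?case by (auto simp: numeral_2_eq_2)
  next
    case (step n)
    show ?case
    proof (cases "s \<le> w n")
      case True
      then show ?thesis using step by fastforce
    next
      case False
      then show ?thesis using step.hyps by (auto intro!: bexI[of _ n])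
    qed
  qed
  from this[of N] show thesis using m s that by (auto simp: is_mesh_def)
qed

lemma has_integral_mesh:
  fixes f :: "real \<Rightarrow> 'a::banach"
  assumes m: "is_mesh N w"
    and f: "\<And>i. i \<in> {1..<N} \<Longrightarrow> (f has_integral I i) {w i..w (Suc i)}"
  shows "(f has_integral (\<Sum>i = 1..<N. I i)) {0..1}"
proof -
  have "n \<le> N \<longrightarrow> (f has_integral (\<Sum>i = 1..<n. I i)) {w 1..w n}" if "1 \<le> n" for n
    using that
  proof (induction n rule: dec_induct)
    case base
    show ?case by (simp add: has_integral_refl)
  next
    case (step n)
    show ?case
    proof
      assume n: "Suc n \<le> N"
      have "w 1 \<le> w n" using mesh_le[OF m, of 1 n] step.hyps n by simp
      moreover have "w n \<le> w (Suc n)" using mesh_step[OF m, of n] step.hyps n by simp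
      ultimately show "(f has_integral (\<Sum>i = 1..<Suc n. I i)) {w 1..w (Suc n)}"
        using has_integral_combine[of "w 1" "w n" "w (Suc n)" f] step f[of n] n by simp
    qed
  qed
  from this[of N] show ?thesis using m by (simp add: is_mesh_def)
qed

text \<open>The value at the vertices is irrelevant for the integral, which is what makes the arbitrary
  vertex values of \<open>du\<close>, of tangents and of elements of \<open>Qh\<close> harmless.\<close>

lemma has_integral_elementwise:
  fixes f :: "real \<Rightarrow> 'a::banach"
  assumes m: "is_mesh N w"
    and g: "\<And>i. i \<in> {1..<N} \<Longrightarrow> (g i has_integral I i) {w i..w (Suc i)}"
    and eq: "\<And>i s. i \<in> {1..<N} \<Longrightarrow> s \<in> {w i<..<w (Suc i)} \<Longrightarrow> f s = g i s"
  shows "(f has_integral (\<Sum>i = 1..<N. I i)) {0..1}"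
proof (rule has_integral_mesh[OF m])
  fix i assume i: "i \<in> {1..<N}"
  show "(f has_integral I i) {w i..w (Suc i)}"
    using has_integral_spike_interior[of "g i" "I i" "w i" "w (Suc i)" f] g[OF i] eq[OF i] by simp
qed

lemma has_integral_elementwise_const:
  fixes f :: "real \<Rightarrow> 'a::banach"
  assumes m: "is_mesh N w"
    and eq: "\<And>i s. i \<in> {1..<N} \<Longrightarrow> s \<in> {w i<..<w (Suc i)} \<Longrightarrow> f s = c i"
  shows "(f has_integral (\<Sum>i = 1..<N. (w (Suc i) - w i) *\<^sub>R c i)) {0..1}"
proof (rule has_integral_elementwise[OF m _ eq])
  fix i assume i: "i \<in> {1..<N}"
  show "((\<lambda>s. c i) has_integral (w (Suc i) - w i) *\<^sub>R c i) {w i..w (Suc i)}"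
    using has_integral_const_real[of "c i" "w i" "w (Suc i)"] mesh_step[OF m i] by simp
qed

lemma integrable_elementwise:
  fixes f :: "real \<Rightarrow> 'a::banach"
  assumes m: "is_mesh N w"
    and g: "\<And>i. i \<in> {1..<N} \<Longrightarrow> g i integrable_on {w i..w (Suc i)}"
    and eq: "\<And>i s. i \<in> {1..<N} \<Longrightarrow> s \<in> {w i<..<w (Suc i)} \<Longrightarrow> f s = g i s"
  shows "f integrable_on {0..1}"
  using has_integral_elementwise[OF m integrable_integral[OF g] eq] by blast


section \<open>Finite element functions\<close>

definition edge :: "(nat \<Rightarrow> real) \<Rightarrow> (real \<Rightarrow> 'a::real_normed_vector) \<Rightarrow> nat \<Rightarrow> 'a" where
  "edge w v i = v (w (Suc i)) - v (w i)"

lemma Vh_on_element: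
  assumes m: "is_mesh N w" and v: "v \<in> Vh N w" and i: "i \<in> {1..<N}"
    and s: "s \<in> {w i..w (Suc i)}"
  shows "v s = v (w i) + ((s - w i) / (w (Suc i) - w i)) *\<^sub>R edge w v i"
proof -
  have less: "w i < w (Suc i)" by (rule mesh_step[OF m i])
  have "\<exists>a b. \<forall>r\<in>{w i..w (Suc i)}. v r = a + r *\<^sub>R b" using v i by (simp add: Vh_def)
  then obtain a b where ab: "\<And>r. r \<in> {w i..w (Suc i)} \<Longrightarrow> v r = a + r *\<^sub>R b" by blast
  have "edge w v i = (w (Suc i) - w i) *\<^sub>R b"
    using ab[of "w i"] ab[of "w (Suc i)"] less by (simp add: edge_def scaleR_diff_left)
  then have "((s - w i) / (w (Suc i) - w i)) *\<^sub>R edge w v i = (s - w i) *\<^sub>R b"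
    using less by simp
  then show ?thesis using ab[OF s] ab[of "w i"] less by (simp add: scaleR_diff_left)
qed

lemma Vh_cong:
  assumes m: "is_mesh N w" and "v \<in> Vh N w" and eq: "\<And>s. s \<in> {0..1} \<Longrightarrow> u s = v s"
  shows "u \<in> Vh N w"
proof -
  have "continuous_on {0..1} u \<longleftrightarrow> continuous_on {0..1} v"
    by (rule continuous_on_cong) (use eq in auto)
  then have "continuous_on {0..1} u" using assms(2) by (simp add: Vh_def)
  moreover have "\<exists>a b. \<forall>s\<in>{w i..w (Suc i)}. u s = a + s *\<^sub>R b" if i: "i \<in> {1..<N}" for i
  proof -
    have "\<exists>a b. \<forall>s\<in>{w i..w (Suc i)}. v s = a + s *\<^sub>R b" using assms(2) i by (simp add: Vh_def)
    then show ?thesis using eq mesh_element_subset[OF m i] by (metis subsetD)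
  qed
  ultimately show ?thesis by (simp add: Vh_def)
qed

lemma interp_in_Vh:
  fixes f :: "real \<Rightarrow> 'a::real_normed_vector"
  assumes m: "is_mesh N w"
  shows "interp N w f \<in> Vh N w"
proof -
  have affine: "\<exists>a b. \<forall>s\<in>{w i..w (Suc i)}. interp N w f s = a + s *\<^sub>R b"
    if i: "i \<in> {1..<N}" for i
  proof -
    define b where "b = (f (w (Suc i)) - f (w i)) /\<^sub>R (w (Suc i) - w i)"
    have "interp N w f s = (f (w i) - w i *\<^sub>R b) + s *\<^sub>R b" if "s \<in> {w i..w (Suc i)}" for s
      using interp_on_element[OF m i that, of f]
      by (simp add: b_def scaleR_diff_left[symmetric] divide_inverse left_diff_distrib)
    then show ?thesis by blast
  qed
  have cont: "continuous_on {w i..w (Suc i)} (interp N w f)" if i: "i \<in> {1..<N}" for i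
  proof -
    obtain a b where "\<forall>s\<in>{w i..w (Suc i)}. interp N w f s = a + s *\<^sub>R b" using affine[OF i] by blast
    then show ?thesis
      by (subst continuous_on_cong[OF refl, where g = "\<lambda>s. a + s *\<^sub>R b"]) (auto intro!: continuous_intros)
  qed
  have "continuous_on (\<Union>i\<in>{1..<N}. {w i..w (Suc i)}) (interp N w f)"
    by (rule continuous_on_closed_Union) (use cont in auto)
  moreover have "{0..1} \<subseteq> (\<Union>i\<in>{1..<N}. {w i..w (Suc i)})"
    using mesh_cover[OF m] by blast
  ultimately show ?thesis
    using affine continuous_on_subset by (auto simp: Vh_def)
qed

text \<open>Only on the open element: at a vertex a piecewise affine function has a kink and \<open>du\<close> takes
  an arbitrary value.\<close>

lemma Vh_has_vector_derivative:
  assumes m: "is_mesh N w" and v: "v \<in> Vh N w" and i: "i \<in> {1..<N}"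
    and s: "s \<in> {w i<..<w (Suc i)}"
  shows "(v has_vector_derivative edge w v i /\<^sub>R (w (Suc i) - w i)) (at s)"
proof -
  have "((\<lambda>r. v (w i) + ((r - w i) / (w (Suc i) - w i)) *\<^sub>R edge w v i)
      has_vector_derivative edge w v i /\<^sub>R (w (Suc i) - w i)) (at s)"
    by (auto intro!: derivative_eq_intros simp: divide_inverse)
  then show ?thesis
    by (rule has_vector_derivative_transform_within_open[where S = "{w i<..<w (Suc i)}"])
      (use Vh_on_element[OF m v i, symmetric] s in simp_all)
qed

lemma du_Vh:
  assumes "is_mesh N w" "v \<in> Vh N w" "i \<in> {1..<N}" "s \<in> {w i<..<w (Suc i)}"
  shows "du v s = edge w v i /\<^sub>R (w (Suc i) - w i)"
  unfolding du_def by (rule vector_derivative_at[OF Vh_has_vector_derivative[OF assms]])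

lemma norm_du_Vh:
  assumes "is_mesh N w" "v \<in> Vh N w" "i \<in> {1..<N}" "s \<in> {w i<..<w (Suc i)}"
  shows "norm (du v s) = norm (edge w v i) / (w (Suc i) - w i)"
  using du_Vh[OF assms] mesh_step[OF assms(1,3)] by (simp add: divide_inverse mult.commute)

lemma tangent_Vh:
  assumes "is_mesh N w" "X \<in> Vh N w" "i \<in> {1..<N}" "s \<in> {w i<..<w (Suc i)}"
  shows "tangent X s = sgn (edge w X i)"
proof -
  have "tangent X s = sgn (du X s)" by (simp add: tangent_def sgn_div_norm)
  then show ?thesis using du_Vh[OF assms] mesh_step[OF assms(1,3)] by (simp add: sgn_scaleR)
qed

text \<open>The midpoint serves as the representative of an open element at which the constant value of
  an element of \<open>Qh\<close> is read off.\<close>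

definition midpt :: "(nat \<Rightarrow> real) \<Rightarrow> nat \<Rightarrow> real" where
  "midpt w i = (w i + w (Suc i)) / 2"

lemma midpt_in:
  assumes "is_mesh N w" "i \<in> {1..<N}"
  shows "midpt w i \<in> {w i<..<w (Suc i)}"
  using mesh_step[OF assms] by (simp add: midpt_def)

lemma Qh_on_element:
  assumes "is_mesh N w" "q \<in> Qh N w" "i \<in> {1..<N}" "s \<in> {w i<..<w (Suc i)}"
  shows "q s = q (midpt w i)"
  using assms midpt_in[OF assms(1,3)] unfolding Qh_def constant_on_def by fastforce


section \<open>Mass lumping\<close>

text \<open>The weight of an element is its length on the curve, the integral of the speed over it, and
  an affine function contributes the mean of its two end values.\<close>

definition lump ::
  "nat \<Rightarrow> (nat \<Rightarrow> real) \<Rightarrow> (real \<Rightarrow> real^3) \<Rightarrow> (real \<Rightarrow> real) \<Rightarrow> real" where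
  "lump N w X f = (\<Sum>i = 1..<N. norm (edge w X i) * ((f (w i) + f (w (Suc i))) / 2))"

lemma has_integral_lump:
  assumes m: "is_mesh N w" and X: "X \<in> Vh N w"
  shows "((\<lambda>u. interp N w f u * norm (du X u)) has_integral lump N w X f) {0..1}"
  unfolding lump_def
proof (rule has_integral_elementwise[OF m])
  fix i assume i: "i \<in> {1..<N}"
  define l h a b c where "l = w i" and "h = w (Suc i) - w i" and "a = f (w i)"
    and "b = f (w (Suc i))" and "c = norm (edge w X i)"
  have h: "h > 0" using mesh_step[OF m i] by (simp add: h_def)
  have "((\<lambda>s. (a + ((s - l) / h) * (b - a)) * (c / h)) has_integral
      (a * (l + h - l) + (l + h - l)\<^sup>2 / (2 * h) * (b - a)) * (c / h)
      - (a * (l - l) + (l - l)\<^sup>2 / (2 * h) * (b - a)) * (c / h)) {l..l + h}"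
    by (rule fundamental_theorem_of_calculus)
      (use h in \<open>auto intro!: derivative_eq_intros 
          simp: has_real_derivative_iff_has_vector_derivative[symmetric] field_simps\<close>)
  moreover have "(a * (l + h - l) + (l + h - l)\<^sup>2 / (2 * h) * (b - a)) * (c / h)
      - (a * (l - l) + (l - l)\<^sup>2 / (2 * h) * (b - a)) * (c / h) = c * ((a + b) / 2)"
    using h by (simp add: field_simps power2_eq_square)
  ultimately have "((\<lambda>s. (a + ((s - l) / h) * (b - a)) * (c / h)) has_integral c * ((a + b) / 2)) {l..l + h}"
    by (simp only:)
  moreover have "l + h = w (Suc i)" by (simp add: l_def h_def)
  ultimately show "((\<lambda>s. (f (w i) + ((s - w i) / (w (Suc i) - w i)) * (f (w (Suc i)) - f (w i)))
        * (norm (edge w X i) / (w (Suc i) - w i)))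
      has_integral norm (edge w X i) * ((f (w i) + f (w (Suc i))) / 2)) {w i..w (Suc i)}"
    by (simp only: l_def h_def a_def b_def c_def)
next
  fix i s assume i: "i \<in> {1..<N}" and s: "s \<in> {w i<..<w (Suc i)}"
  show "interp N w f s * norm (du X s)
      = (f (w i) + ((s - w i) / (w (Suc i) - w i)) * (f (w (Suc i)) - f (w i)))
        * (norm (edge w X i) / (w (Suc i) - w i))"
    using interp_on_element[OF m i, of s f] norm_du_Vh[OF m X i s] s by simp
qed

lemma lump_cong:
  assumes "\<And>i. i \<in> {1..N} \<Longrightarrow> f (w i) = g (w i)"
  shows "lump N w X f = lump N w X g"
  unfolding lump_def using assms by (intro sum.cong) auto

lemma lump_add: "lump N w X (\<lambda>s. f s + g s) = lump N w X f + lump N w X g"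
  by (simp add: lump_def sum.distrib[symmetric] algebra_simps add_divide_distrib)

lemma lump_diff: "lump N w X (\<lambda>s. f s - g s) = lump N w X f - lump N w X g"
  by (simp add: lump_def sum_subtractf[symmetric] algebra_simps add_divide_distrib diff_divide_distrib)

text \<open>The nodal basis function of the vertex \<open>w k\<close>, times \<open>c\<close>.\<close>

definition spike :: "nat \<Rightarrow> (nat \<Rightarrow> real) \<Rightarrow> nat \<Rightarrow> 'a \<Rightarrow> real \<Rightarrow> 'a::real_normed_vector" where
  "spike N w k c = interp N w (\<lambda>s. if s = w k then c else 0)"

lemma mesh_inj:
  assumes "is_mesh N w" "i \<in> {1..N}" "j \<in> {1..N}"
  shows "w i = w j \<longleftrightarrow> i = j"
  using mesh_less[OF assms(1), of i j] mesh_less[OF assms(1), of j i] assms(2,3)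
  by (cases i j rule: linorder_cases) auto

lemma spike_node:
  assumes "is_mesh N w" "i \<in> {1..N}" "k \<in> {1..N}"
  shows "spike N w k c (w i) = (if i = k then c else 0)"
  using assms mesh_inj[OF assms] by (simp add: spike_def interp_vertex)

lemma spike_Vh: "is_mesh N w \<Longrightarrow> spike N w k c \<in> Vh N w"
  unfolding spike_def by (rule interp_in_Vh)

lemma spike_Vh0:
  assumes m: "is_mesh N w" and k: "k \<in> {1<..<N}"
  shows "spike N w k c \<in> Vh0 N w"
  using spike_Vh[OF m, of k c] spike_node[OF m, of 1 k c] spike_node[OF m, of N k c] m k
  by (auto simp: Vh0_def is_mesh_def)

text \<open>A lumped equation holds at each vertex separately: testing with the nodal basis function whose
  coefficient is the residual \<open>g (w k)\<close> itself leaves a sum of squares with nonnegative weights, and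
  the vertex belongs to at least one element of positive length.\<close>

lemma lump_spike_eq_0:
  assumes m: "is_mesh N w" and k: "k \<in> {1..N}"
    and reg: "\<And>i. i \<in> {1..<N} \<Longrightarrow> edge w X i \<noteq> 0"
    and zero: "lump N w X (\<lambda>s. g s \<bullet> spike N w k (g (w k)) s) = 0"
  shows "g (w k) = 0"
proof -
  let ?c = "\<lambda>i. if i = k then g (w k) \<bullet> g (w k) else 0"
  have node: "g (w i) \<bullet> spike N w k (g (w k)) (w i) = ?c i" if "i \<in> {1..N}" for i
    by (cases "i = k") (simp_all add: spike_node[OF m that k] spike_node[OF m k k])
  have "lump N w X (\<lambda>s. g s \<bullet> spike N w k (g (w k)) s)
      = (\<Sum>i = 1..<N. norm (edge w X i) * ((?c i + ?c (Suc i)) / 2))"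
    unfolding lump_def
  proof (rule sum.cong[OF refl])
    fix i assume "i \<in> {1..<N}"
    then show "norm (edge w X i) * ((g (w i) \<bullet> spike N w k (g (w k)) (w i)
        + g (w (Suc i)) \<bullet> spike N w k (g (w k)) (w (Suc i))) / 2)
      = norm (edge w X i) * ((?c i + ?c (Suc i)) / 2)"
      using node[of i] node[of "Suc i"] by simp
  qed
  then have "(\<Sum>i = 1..<N. norm (edge w X i) * ((?c i + ?c (Suc i)) / 2)) = 0"
    using zero by simp
  then have all: "\<forall>i\<in>{1..<N}. norm (edge w X i) * ((?c i + ?c (Suc i)) / 2) = 0"
    by (subst (asm) sum_nonneg_eq_0_iff) auto
  have N: "N \<ge> 2" using m by (simp add: is_mesh_def)
  \<comment> \<open>An element having the vertex as an end point; the last vertex is only a right end point.\<close>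
  define j where "j = (if k = N then N - 1 else k)"
  have j: "j \<in> {1..<N}" "k = j \<or> k = Suc j" using k N by (auto simp: j_def)
  have "?c j + ?c (Suc j) = 0" using all reg[OF j(1)] j(1) by auto
  then show ?thesis using j(2) by auto
qed


section \<open>Time derivatives of finite element functions\<close>

lemma dt_has_vector_derivative:
  "(\<lambda>r. f r s) differentiable at t \<Longrightarrow> ((\<lambda>r. f r s) has_vector_derivative dt f t s) (at t)"
  unfolding dt_def by (simp add: vector_derivative_works)

text \<open>Since the value at \<open>s\<close> is a time-independent affine combination of two vertex values,
  differentiability in time is inherited from the vertices. This is how it reaches \<open>\<alpha>\<close> and \<open>\<beta>\<close>,
  which are controlled at the vertices only.\<close>

lemma Vh_time_derivative:
  assumes m: "is_mesh N w" and S: "open S" "t \<in> S" and V: "\<And>r. r \<in> S \<Longrightarrow> f r \<in> Vh N w"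
    and diff: "\<And>i. i \<in> {1..N} \<Longrightarrow> (\<lambda>r. f r (w i)) differentiable at t"
    and s: "s \<in> {0..1}"
  shows "((\<lambda>r. f r s) has_vector_derivative interp N w (dt f t) s) (at t)"
proof -
  obtain i where i: "i \<in> {1..<N}" "s \<in> {w i..w (Suc i)}" using mesh_cover[OF m s] .
  let ?q = "(s - w i) / (w (Suc i) - w i)"
  have d: "((\<lambda>r. f r (w i)) has_vector_derivative dt f t (w i)) (at t)"
    "((\<lambda>r. f r (w (Suc i))) has_vector_derivative dt f t (w (Suc i))) (at t)"
    using diff[of i] diff[of "Suc i"] i(1) by (auto intro: dt_has_vector_derivative)
  have "((\<lambda>r. f r (w i) + ?q *\<^sub>R (f r (w (Suc i)) - f r (w i))) has_vector_derivative
      dt f t (w i) + ?q *\<^sub>R (dt f t (w (Suc i)) - dt f t (w i))) (at t)"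
    by (intro has_vector_derivative_add has_vector_derivative_diff d
        bounded_linear.has_vector_derivative[OF bounded_linear_scaleR_right])
  then have "((\<lambda>r. f r (w i) + ?q *\<^sub>R (f r (w (Suc i)) - f r (w i))) has_vector_derivative
      interp N w (dt f t) s) (at t)"
    by (simp only: interp_on_element[OF m i])
  then show ?thesis
  proof (rule has_vector_derivative_transform_within_open[OF _ S])
    fix r assume "r \<in> S"
    then show "f r (w i) + ?q *\<^sub>R (f r (w (Suc i)) - f r (w i)) = f r s"
      using Vh_on_element[OF m V i] by (simp add: edge_def)
  qed
qed

lemma dt_in_Vh:
  assumes m: "is_mesh N w" and S: "open S" "t \<in> S" and V: "\<And>r. r \<in> S \<Longrightarrow> f r \<in> Vh N w"
    and diff: "\<And>i. i \<in> {1..N} \<Longrightarrow> (\<lambda>r. f r (w i)) differentiable at t"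
  shows "dt f t \<in> Vh N w"
proof (rule Vh_cong[OF m interp_in_Vh[OF m]])
  fix s :: real assume "s \<in> {0..1}"
  then show "dt f t s = interp N w (dt f t) s"
    using vector_derivative_at[OF Vh_time_derivative[OF assms]] by (simp add: dt_def)
qed

lemma edge_has_vector_derivative:
  assumes "(\<lambda>r. f r (w i)) differentiable at t" "(\<lambda>r. f r (w (Suc i))) differentiable at t"
  shows "((\<lambda>r. edge w (f r) i) has_vector_derivative edge w (dt f t) i) (at t)"
  unfolding edge_def
  by (intro has_vector_derivative_diff dt_has_vector_derivative assms)

lemma inner_has_real_derivative:
  fixes f g :: "real \<Rightarrow> 'a::real_inner"
  assumes "(f has_vector_derivative f') (at t)" "(g has_vector_derivative g') (at t)"
  shows "((\<lambda>r. f r \<bullet> g r) has_real_derivative (f t \<bullet> g' + f' \<bullet> g t)) (at t)"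
  using bounded_bilinear.has_vector_derivative[OF bounded_bilinear_inner assms]
  by (simp add: has_real_derivative_iff_has_vector_derivative)

lemma norm_has_real_derivative:
  fixes f :: "real \<Rightarrow> 'a::real_inner"
  assumes f: "(f has_vector_derivative f') (at t)" and "f t \<noteq> 0"
  shows "((\<lambda>r. norm (f r)) has_real_derivative sgn (f t) \<bullet> f') (at t)"
proof -
  have "((\<lambda>r. sqrt (f r \<bullet> f r)) has_real_derivative
      inverse (sqrt (f t \<bullet> f t)) / 2 * (f t \<bullet> f' + f' \<bullet> f t)) (at t)"
    by (rule DERIV_chain2[OF DERIV_real_sqrt inner_has_real_derivative[OF f f]])
      (use assms(2) in simp)
  then show ?thesis
    by (simp add: norm_eq_sqrt_inner[symmetric] sgn_div_norm inner_commute)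
qed

lemma sgn_has_vector_derivative:
  fixes f :: "real \<Rightarrow> 'a::real_inner"
  assumes f: "(f has_vector_derivative f') (at t)" and nz: "f t \<noteq> 0"
  shows "((\<lambda>r. sgn (f r)) has_vector_derivative
    (f' - (sgn (f t) \<bullet> f') *\<^sub>R sgn (f t)) /\<^sub>R norm (f t)) (at t)"
proof -
  have "((\<lambda>r. inverse (norm (f r))) has_real_derivative
      - (inverse (norm (f t)) * (sgn (f t) \<bullet> f') * inverse (norm (f t)))) (at t)"
    by (rule DERIV_inverse'[OF norm_has_real_derivative[OF assms]]) (use nz in simp)
  from has_vector_derivative_scaleR[OF this f]
  show ?thesis
    by (simp add: sgn_div_norm algebra_simps)
qed


section \<open>Vertex tangents\<close>

text \<open>Both exceptional cases mirror the convention that a missing element at an end point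
  contributes \<open>0\<close>.\<close>

definition tangent_sum ::
  "nat \<Rightarrow> (nat \<Rightarrow> real) \<Rightarrow> (real \<Rightarrow> real^3) \<Rightarrow> nat \<Rightarrow> real^3" where
  "tangent_sum N w X i = (if i = 1 then 0 else sgn (edge w X (i - 1)))
     + (if i = N then 0 else sgn (edge w X i))"

lemma one_sided_tangents:
  assumes m: "is_mesh N w" and X: "X \<in> Vh N w" and i: "i \<in> {1..N}"
  shows "tangent_left X (w i) + tangent_right X (w i) = tangent_sum N w X i"
proof -
  have ends: "w i = 0 \<longleftrightarrow> i = 1" "w i = 1 \<longleftrightarrow> i = N"
    using mesh_inj[OF m i, of 1] mesh_inj[OF m i, of N] m by (auto simp: is_mesh_def)
  have "Lim (at_left (w i)) (tangent X) = sgn (edge w X (i - 1))" if "i \<noteq> 1"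
  proof (rule tendsto_Lim)
    have j: "i - 1 \<in> {1..<N}" "Suc (i - 1) = i" using i that by auto
    have "\<forall>\<^sub>F s in at_left (w i). s \<in> {w (i - 1)<..<w i}"
      using eventually_at_left_real mesh_step[OF m j(1)] j(2) by simp
    then have "\<forall>\<^sub>F s in at_left (w i). tangent X s = sgn (edge w X (i - 1))"
      by eventually_elim (rule tangent_Vh[OF m X j(1)], use j(2) in simp)
    then show "(tangent X \<longlongrightarrow> sgn (edge w X (i - 1))) (at_left (w i))"
      by (rule tendsto_eventually)
  qed simp
  moreover have "Lim (at_right (w i)) (tangent X) = sgn (edge w X i)" if "i \<noteq> N"
  proof (rule tendsto_Lim)
    have j: "i \<in> {1..<N}" using i that by auto
    have "\<forall>\<^sub>F s in at_right (w i). s \<in> {w i<..<w (Suc i)}"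
      using eventually_at_right_real mesh_step[OF m j] by simp
    then have "\<forall>\<^sub>F s in at_right (w i). tangent X s = sgn (edge w X i)"
      by eventually_elim (rule tangent_Vh[OF m X j], simp)
    then show "(tangent X \<longlongrightarrow> sgn (edge w X i)) (at_right (w i))"
      by (rule tendsto_eventually)
  qed simp
  ultimately show ?thesis
    by (auto simp: tangent_left_def tangent_right_def tangent_sum_def ends)
qed

lemma vertex_tangent_node:
  assumes m: "is_mesh N w" and X: "X \<in> Vh N w" and i: "i \<in> {1..N}"
  shows "vertex_tangent N w X (w i) = sgn (tangent_sum N w X i)"
  unfolding vertex_tangent_def interp_vertex[OF m i] one_sided_tangents[OF assms]
  by (simp add: sgn_div_norm)

lemma regular_curve_edge:
  assumes m: "is_mesh N w" and X: "X \<in> Vh N w" and reg: "regular_curve N w X"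
    and i: "i \<in> {1..<N}"
  shows "edge w X i \<noteq> 0"
  using reg i midpt_in[OF m i] du_Vh[OF m X i midpt_in[OF m i]] by (auto simp: regular_curve_def)

lemma regular_curve_tangent_sum:
  assumes "is_mesh N w" "X \<in> Vh N w" "regular_curve N w X" "i \<in> {1..N}"
  shows "tangent_sum N w X i \<noteq> 0"
proof -
  have "tangent_left X (w i) + tangent_right X (w i) \<noteq> 0"
    using assms(3,4) unfolding regular_curve_def by blast
  then show ?thesis by (simp only: one_sided_tangents[OF assms(1,2,4)] not_False_eq_True)
qed

lemma sgn_differentiable:
  fixes f :: "real \<Rightarrow> 'a::real_inner"
  shows "f differentiable at t \<Longrightarrow> f t \<noteq> 0 \<Longrightarrow> (\<lambda>r. sgn (f r)) differentiable at t"
  using sgn_has_vector_derivative vector_derivative_works differentiableI_vector by metis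

lemma vertex_tangent_differentiable:
  fixes x :: "real \<Rightarrow> real \<Rightarrow> real^3"
  assumes m: "is_mesh N w" and S: "open S" "t \<in> S" and V: "\<And>r. r \<in> S \<Longrightarrow> x r \<in> Vh N w"
    and diff: "\<And>i. i \<in> {1..N} \<Longrightarrow> (\<lambda>r. x r (w i)) differentiable at t"
    and reg: "regular_curve N w (x t)" and i: "i \<in> {1..N}"
  shows "(\<lambda>r. vertex_tangent N w (x r) (w i)) differentiable at t"
proof -
  have edge: "(\<lambda>r. sgn (edge w (x r) j)) differentiable at t" if j: "j \<in> {1..<N}" for j
    using differentiableI_vector[OF edge_has_vector_derivative[of x w j t]] diff[of j] diff[of "Suc j"] j
      regular_curve_edge[OF m V[OF S(2)] reg j]
    by (intro sgn_differentiable) auto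
  have adj: "i \<noteq> 1 \<Longrightarrow> i - 1 \<in> {1..<N}" "i \<noteq> N \<Longrightarrow> i \<in> {1..<N}" using i by auto
  have "(\<lambda>r. tangent_sum N w (x r) i) differentiable at t"
    unfolding tangent_sum_def using edge[OF adj(1)] edge[OF adj(2)]
    by (cases "i = 1"; cases "i = N") simp_all
  then have "(\<lambda>r. sgn (tangent_sum N w (x r) i)) differentiable at t"
    by (rule sgn_differentiable) (rule regular_curve_tangent_sum[OF m V[OF S(2)] reg i])
  then obtain D where "((\<lambda>r. sgn (tangent_sum N w (x r) i)) has_vector_derivative D) (at t)"
    using vector_derivative_works by blast
  then have "((\<lambda>r. vertex_tangent N w (x r) (w i)) has_vector_derivative D) (at t)"
    by (rule has_vector_derivative_transform_within_open[OF _ S])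
      (simp add: vertex_tangent_node[OF m V i])
  then show ?thesis by (rule differentiableI_vector)
qed

lemma vertex_tangent_continuous_on:
  fixes x :: "real \<Rightarrow> real \<Rightarrow> real^3"
  assumes m: "is_mesh N w" and V: "\<And>r. r \<in> S \<Longrightarrow> x r \<in> Vh N w"
    and cont: "\<And>i. i \<in> {1..N} \<Longrightarrow> continuous_on S (\<lambda>r. x r (w i))"
    and reg: "\<And>r. r \<in> S \<Longrightarrow> regular_curve N w (x r)" and i: "i \<in> {1..N}"
  shows "continuous_on S (\<lambda>r. vertex_tangent N w (x r) (w i))"
proof -
  have edge: "continuous_on S (\<lambda>r. sgn (edge w (x r) j))" if j: "j \<in> {1..<N}" for j
    using j cont[of j] cont[of "Suc j"] regular_curve_edge[OF m V reg j]
    by (intro continuous_on_sgn) (auto simp: edge_def intro!: continuous_intros)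
  have adj: "i \<noteq> 1 \<Longrightarrow> i - 1 \<in> {1..<N}" "i \<noteq> N \<Longrightarrow> i \<in> {1..<N}" using i by auto
  have "continuous_on S (\<lambda>r. tangent_sum N w (x r) i)"
    unfolding tangent_sum_def using edge[OF adj(1)] edge[OF adj(2)]
    by (cases "i = 1"; cases "i = N") (simp_all add: continuous_on_add)
  then have "continuous_on S (\<lambda>r. sgn (tangent_sum N w (x r) i))"
    by (rule continuous_on_sgn) (use regular_curve_tangent_sum[OF m V reg i] in blast)
  then show ?thesis
    by (subst continuous_on_cong[OF refl vertex_tangent_node[OF m V i]])
qed


section \<open>The discrete frame\<close>

lemma outer_mult_vec: "(a \<otimes> b) *v c = (b \<bullet> c) *\<^sub>R a"
  by (simp add: vec_eq_iff outer_def matrix_vector_mult_def inner_vec_def sum_distrib_left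
      sum_distrib_right algebra_simps)

lemma tangential_projection: "(mat 1 - a \<otimes> a) *v c = c - (a \<bullet> c) *\<^sub>R a"
  by (simp add: matrix_vector_mult_diff_rdistrib outer_mult_vec)

text \<open>Inner products of vectors that rotate with a common angular velocity \<open>\<omega>\<close> are conserved, as
  \<open>\<omega> \<times> _\<close> is skew. Continuity reaches down to time \<open>0\<close>, where the equations of motion need not
  hold.\<close>

lemma rigid_rotation_inner_const:
  fixes f g \<omega> :: "real \<Rightarrow> real^3"
  assumes f: "\<And>r. r \<in> {0<..<T} \<Longrightarrow> (f has_vector_derivative \<omega> r \<times> f r) (at r)"
    and g: "\<And>r. r \<in> {0<..<T} \<Longrightarrow> (g has_vector_derivative \<omega> r \<times> g r) (at r)"
    and cont: "continuous_on {0..<T} f" "continuous_on {0..<T} g"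
    and t: "t \<in> {0<..<T}"
  shows "f t \<bullet> g t = f 0 \<bullet> g 0"
proof (rule DERIV_isconst_end[of 0 t "\<lambda>r. f r \<bullet> g r"])
  show "continuous_on {0..t} (\<lambda>r. f r \<bullet> g r)"
    using t by (intro continuous_intros continuous_on_subset[OF cont(1)] continuous_on_subset[OF cont(2)]) auto
next
  fix r assume r: "0 < r" "r < t"
  have "f r \<bullet> (\<omega> r \<times> g r) + (\<omega> r \<times> f r) \<bullet> g r = 0"
    by (simp add: cross3_simps)
  then show "((\<lambda>r. f r \<bullet> g r) has_real_derivative 0) (at r)"
    using inner_has_real_derivative[OF f g, of r] r t by simp
qed (use t in auto)

text \<open>The angular velocity prescribed by the frame equation reproduces the motion of the tangent, so
  the tangent is the third vector of the rotating frame.\<close>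

lemma unit_tangent_spin:
  fixes \<tau> \<tau>' :: "real^3"
  assumes "norm \<tau> = 1" "\<tau> \<bullet> \<tau>' = 0"
  shows "(\<tau> \<times> \<tau>' + c *\<^sub>R \<tau>) \<times> \<tau> = \<tau>'"
proof -
  have "(\<tau> \<times> \<tau>') \<times> \<tau> = - (\<tau> \<times> (\<tau> \<times> \<tau>'))" by (rule cross_skew)
  also have "\<dots> = \<tau>'" using assms by (simp add: Lagrange norm_eq_1)
  finally show ?thesis by (simp add: cross_add_left cross_mult_left)
qed

text \<open>Bending power at a vertex. The spin \<open>\<tau> \<times> \<tau>'\<close> moves the curvature, which is orthogonal to
  \<open>\<tau>\<close>, only along \<open>\<tau>\<close>, and the spin \<open>c *\<^sub>R \<tau>\<close> is exactly the term subtracted. So up to a multiple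
  of \<open>\<tau>\<close> the corotational rate \<open>\<kappa>' - c *\<^sub>R (\<tau> \<times> \<kappa>)\<close> is \<open>a' *\<^sub>R e1 + b' *\<^sub>R e2\<close>. The projection in
  the constitutive law removes that multiple, which puts \<open>y\<close> in the span of \<open>e1\<close> and \<open>e2\<close>, and
  pairing with \<open>y\<close> then ignores it.\<close>

lemma curvature_power:
  fixes \<tau> \<tau>' e1 e2 \<kappa> \<kappa>' y :: "real^3"
  assumes on: "orthonormal3 \<tau> e1 e2"
    and \<kappa>: "\<kappa> = a *\<^sub>R e1 + b *\<^sub>R e2"
    and e': "e1' = (\<tau> \<times> \<tau>' + c *\<^sub>R \<tau>) \<times> e1" "e2' = (\<tau> \<times> \<tau>' + c *\<^sub>R \<tau>) \<times> e2"
    and \<kappa>': "\<kappa>' = a' *\<^sub>R e1 + b' *\<^sub>R e2 + a *\<^sub>R e1' + b *\<^sub>R e2'"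
    and y: "y = A *\<^sub>R (\<kappa> - a0 *\<^sub>R e1 - b0 *\<^sub>R e2)
      + B *\<^sub>R ((mat 1 - \<tau> \<otimes> \<tau>) *v \<kappa>' - c *\<^sub>R (\<tau> \<times> \<kappa>))"
  shows "y \<bullet> (\<kappa>' - c *\<^sub>R (\<tau> \<times> \<kappa>))
    = A * ((a - a0) * a' + (b - b0) * b') + B * (a'\<^sup>2 + b'\<^sup>2)"
proof -
  have o: "\<tau> \<bullet> \<tau> = 1" "e1 \<bullet> e1 = 1" "e2 \<bullet> e2 = 1" "\<tau> \<bullet> e1 = 0" "\<tau> \<bullet> e2 = 0" "e1 \<bullet> e2 = 0"
    "e1 \<bullet> \<tau> = 0" "e2 \<bullet> \<tau> = 0" "e2 \<bullet> e1 = 0"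
    using on by (auto simp: orthonormal3_def norm_eq_1 inner_commute)
  define d where "d = a' *\<^sub>R e1 + b' *\<^sub>R e2"
  have \<tau>\<kappa>: "\<kappa> \<bullet> \<tau> = 0" by (simp add: \<kappa> o inner_add_left)
  have "(\<tau> \<times> \<tau>') \<times> \<kappa> = - (\<kappa> \<times> (\<tau> \<times> \<tau>'))" by (rule cross_skew)
  also have "\<dots> = - (\<kappa> \<bullet> \<tau>') *\<^sub>R \<tau>" by (simp add: Lagrange \<tau>\<kappa>)
  finally have spin: "(\<tau> \<times> \<tau>') \<times> \<kappa> = - (\<kappa> \<bullet> \<tau>') *\<^sub>R \<tau>" .
  have "a *\<^sub>R e1' + b *\<^sub>R e2' = (\<tau> \<times> \<tau>' + c *\<^sub>R \<tau>) \<times> \<kappa>"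
    by (simp add: e' \<kappa> cross_add_right cross_mult_right)
  then have \<kappa>'_eq: "\<kappa>' = d - (\<kappa> \<bullet> \<tau>') *\<^sub>R \<tau> + c *\<^sub>R (\<tau> \<times> \<kappa>)"
    by (simp add: \<kappa>' d_def cross_add_left cross_mult_left spin add.assoc)
  have "\<tau> \<bullet> \<kappa>' = - (\<kappa> \<bullet> \<tau>')"
    by (simp add: \<kappa>'_eq inner_add_right inner_diff_right d_def o dot_cross_self)
  then have proj: "(mat 1 - \<tau> \<otimes> \<tau>) *v \<kappa>' - c *\<^sub>R (\<tau> \<times> \<kappa>) = d"
    unfolding tangential_projection by (simp add: \<kappa>'_eq)
  have y_eq: "y = (A * (a - a0) + B * a') *\<^sub>R e1 + (A * (b - b0) + B * b') *\<^sub>R e2"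
    unfolding y proj by (simp add: \<kappa> d_def algebra_simps)
  show ?thesis
    by (simp add: \<kappa>'_eq y_eq d_def inner_add_left inner_add_right inner_diff_right o
        algebra_simps power2_eq_square)
qed


text \<open>Here \<open>\<theta>\<close> is a unit vector with prescribed motion, and the spin of the frame about \<open>\<theta>\<close> is an
  arbitrary function \<open>c\<close>. All three vectors rotate with the same angular velocity.\<close>

lemma frame_orthonormal:
  fixes \<theta> \<theta>' e1 e2 :: "real \<Rightarrow> real^3"
  assumes \<theta>: "\<And>r. r \<in> {0<..<T} \<Longrightarrow> (\<theta> has_vector_derivative \<theta>' r) (at r)"
    and unit: "\<And>r. r \<in> {0..<T} \<Longrightarrow> norm (\<theta> r) = 1"
    and e1: "\<And>r. r \<in> {0<..<T} \<Longrightarrow>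
      (e1 has_vector_derivative (\<theta> r \<times> \<theta>' r + c r *\<^sub>R \<theta> r) \<times> e1 r) (at r)"
    and e2: "\<And>r. r \<in> {0<..<T} \<Longrightarrow>
      (e2 has_vector_derivative (\<theta> r \<times> \<theta>' r + c r *\<^sub>R \<theta> r) \<times> e2 r) (at r)"
    and cont: "continuous_on {0..<T} \<theta>" "continuous_on {0..<T} e1" "continuous_on {0..<T} e2"
    and init: "orthonormal3 (\<theta> 0) (e1 0) (e2 0)"
    and t: "t \<in> {0<..<T}"
  shows "orthonormal3 (\<theta> t) (e1 t) (e2 t)"
proof -
  have orth: "\<theta> r \<bullet> \<theta>' r = 0" if r: "r \<in> {0<..<T}" for r
  proof -
    have "((\<lambda>r. 1) has_real_derivative \<theta> r \<bullet> \<theta>' r + \<theta>' r \<bullet> \<theta> r) (at r)"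
      by (rule DERIV_cong_ev[THEN iffD1, OF refl _ refl inner_has_real_derivative[OF \<theta> \<theta>, OF r r]])
        (rule eventually_mono[OF eventually_nhds_in_open[of "{0<..<T}" r]],
          use r unit in \<open>auto simp: norm_eq_1\<close>)
    then have "\<theta> r \<bullet> \<theta>' r + \<theta>' r \<bullet> \<theta> r = 0" using DERIV_unique DERIV_const by blast
    then show ?thesis by (simp add: inner_commute)
  qed
  have \<theta>_rot: "(\<theta> has_vector_derivative (\<theta> r \<times> \<theta>' r + c r *\<^sub>R \<theta> r) \<times> \<theta> r) (at r)"
    if r: "r \<in> {0<..<T}" for r
    using \<theta>[OF r] unit_tangent_spin[OF unit orth[OF r]] r by simp
  note const = rigid_rotation_inner_const[where \<omega> = "\<lambda>r. \<theta> r \<times> \<theta>' r + c r *\<^sub>R \<theta> r" and t = t and T = T, OF _ _ _ _ t]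
  show ?thesis
    using init const[OF \<theta>_rot \<theta>_rot cont(1) cont(1)] const[OF e1 e1 cont(2) cont(2)]
      const[OF e2 e2 cont(3) cont(3)] const[OF \<theta>_rot e1 cont(1) cont(2)]
      const[OF \<theta>_rot e2 cont(1) cont(3)] const[OF e1 e2 cont(2) cont(3)]
    by (simp add: orthonormal3_def norm_eq_1)
qed


section \<open>Testing the discrete equations\<close>

lemma QhI:
  assumes "\<And>i s. i \<in> {1..<N} \<Longrightarrow> s \<in> {w i<..<w (Suc i)} \<Longrightarrow> q s = c i"
  shows "q \<in> Qh N w"
  unfolding Qh_def constant_on_def using assms by blast

text \<open>On each element the stretching rate \<open>tangent X s \<bullet> du V s\<close> is constant, so it is itself an
  admissible test function, and the equation says that its square has integral zero.\<close>

lemma inextensible_edges: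
  assumes m: "is_mesh N w" and X: "X \<in> Vh N w" and V: "V \<in> Vh N w"
    and eq: "\<And>q. q \<in> Qh N w \<Longrightarrow> integral {0..1} (\<lambda>s. q s * (tangent X s \<bullet> du V s)) = 0"
    and i: "i \<in> {1..<N}"
  shows "sgn (edge w X i) \<bullet> edge w V i = 0"
proof -
  define c where "c i = sgn (edge w X i) \<bullet> edge w V i / (w (Suc i) - w i)" for i
  define q where "q s = tangent X s \<bullet> du V s" for s
  have q: "q s = c i" if "i \<in> {1..<N}" "s \<in> {w i<..<w (Suc i)}" for i s
    using tangent_Vh[OF m X that] du_Vh[OF m V that] by (simp add: q_def c_def divide_inverse)
  have "integral {0..1} (\<lambda>s. q s * q s) = 0"
    using eq[OF QhI[OF q]] by (simp add: q_def)
  moreover have "integral {0..1} (\<lambda>s. q s * q s)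
      = (\<Sum>i = 1..<N. (w (Suc i) - w i) *\<^sub>R (c i * c i))"
    by (rule integral_unique[OF has_integral_elementwise_const[OF m]]) (use q in simp)
  ultimately have "\<forall>i\<in>{1..<N}. (w (Suc i) - w i) *\<^sub>R (c i * c i) = 0"
    using sum_nonneg_eq_0_iff[of "{1..<N}" "\<lambda>i. (w (Suc i) - w i) *\<^sub>R (c i * c i)"]
      mesh_step[OF m] by (simp add: less_imp_le)
  then have "c i = 0"
    using i mesh_step[OF m i]
    by (metis mult_eq_0_iff real_scaleR_def eq_iff_diff_eq_0 less_irrefl)
  then show ?thesis using mesh_step[OF m i] by (simp add: c_def)
qed

text \<open>Because the elements keep their lengths to first order, the weights do not contribute.\<close>

lemma lump_has_real_derivative:
  assumes x: "\<And>i. i \<in> {1..N} \<Longrightarrow> (\<lambda>r. x r (w i)) differentiable at t"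
    and reg: "\<And>i. i \<in> {1..<N} \<Longrightarrow> edge w (x t) i \<noteq> 0"
    and inext: "\<And>i. i \<in> {1..<N} \<Longrightarrow> sgn (edge w (x t) i) \<bullet> edge w (dt x t) i = 0"
    and f: "\<And>i. i \<in> {1..N} \<Longrightarrow> ((\<lambda>r. f r (w i)) has_real_derivative f' (w i)) (at t)"
  shows "((\<lambda>r. lump N w (x r) (f r)) has_real_derivative lump N w (x t) f') (at t)"
  unfolding lump_def
proof (rule DERIV_sum)
  fix i assume i: "i \<in> {1..<N}"
  have "((\<lambda>r. norm (edge w (x r) i)) has_real_derivative 0) (at t)"
    using norm_has_real_derivative[OF edge_has_vector_derivative[of x w i t, OF x x] reg[OF i]]
      inext[OF i] i by simp
  moreover have "((\<lambda>r. (f r (w i) + f r (w (Suc i))) / 2) has_real_derivative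
      (f' (w i) + f' (w (Suc i))) / 2) (at t)"
    using i by (intro DERIV_cdivide DERIV_add f) auto
  ultimately have "((\<lambda>r. norm (edge w (x r) i) * ((f r (w i) + f r (w (Suc i))) / 2))
      has_real_derivative 0 * ((f t (w i) + f t (w (Suc i))) / 2)
        + (f' (w i) + f' (w (Suc i))) / 2 * norm (edge w (x t) i)) (at t)"
    by (rule DERIV_mult)
  then show "((\<lambda>r. norm (edge w (x r) i) * ((f r (w i) + f r (w (Suc i))) / 2))
      has_real_derivative norm (edge w (x t) i) * ((f' (w i) + f' (w (Suc i))) / 2)) (at t)"
    by (simp add: mult.commute)
qed

lemma curvature_equation_nodal:
  assumes m: "is_mesh N w" and X: "X \<in> Vh N w" and \<psi>: "\<psi> \<in> Vh N w"
  shows "integral {0..1} (\<lambda>u. interp N w (\<lambda>s. k s \<bullet> \<psi> s) u * norm (du X u)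
      + (du X u /\<^sub>R norm (du X u)) \<bullet> du \<psi> u)
    = lump N w X (\<lambda>s. k s \<bullet> \<psi> s) + (\<Sum>i = 1..<N. sgn (edge w X i) \<bullet> edge w \<psi> i)"
proof (rule integral_unique[OF has_integral_add[OF has_integral_lump[OF m X]]])
  have "((\<lambda>u. (du X u /\<^sub>R norm (du X u)) \<bullet> du \<psi> u) has_integral
      (\<Sum>i = 1..<N. (w (Suc i) - w i) *\<^sub>R
        (sgn (edge w X i) \<bullet> (edge w \<psi> i /\<^sub>R (w (Suc i) - w i))))) {0..1}"
    by (rule has_integral_elementwise_const[OF m])
      (simp only: tangent_def[symmetric] tangent_Vh[OF m X] du_Vh[OF m \<psi>])
  moreover have "(\<Sum>i = 1..<N. (w (Suc i) - w i) *\<^sub>R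
        (sgn (edge w X i) \<bullet> (edge w \<psi> i /\<^sub>R (w (Suc i) - w i))))
      = (\<Sum>i = 1..<N. sgn (edge w X i) \<bullet> edge w \<psi> i)"
    by (rule sum.cong[OF refl]) (use mesh_step[OF m] in fastforce)
  ultimately show "((\<lambda>u. (du X u /\<^sub>R norm (du X u)) \<bullet> du \<psi> u) has_integral
      (\<Sum>i = 1..<N. sgn (edge w X i) \<bullet> edge w \<psi> i)) {0..1}"
    by (simp only:)
qed

text \<open>The time derivative of the discrete curvature equation for a fixed test function. The
  derivative of the unit tangent is the projection of the rate of the edge divided by its length, and
  inextensibility makes the projection superfluous.\<close>

lemma curvature_rate:
  assumes m: "is_mesh N w" and S: "open S" "t \<in> S"
    and V: "\<And>r. r \<in> S \<Longrightarrow> x r \<in> Vh N w" and \<psi>: "\<psi> \<in> Vh N w"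
    and x: "\<And>i. i \<in> {1..N} \<Longrightarrow> (\<lambda>r. x r (w i)) differentiable at t"
    and \<kappa>: "\<And>i. i \<in> {1..N} \<Longrightarrow> (\<lambda>r. \<kappa> r (w i)) differentiable at t"
    and reg: "\<And>i. i \<in> {1..<N} \<Longrightarrow> edge w (x t) i \<noteq> 0"
    and inext: "\<And>i. i \<in> {1..<N} \<Longrightarrow> sgn (edge w (x t) i) \<bullet> edge w (dt x t) i = 0"
    and eq: "\<And>r. r \<in> S \<Longrightarrow> integral {0..1} (\<lambda>u. interp N w (\<lambda>s. \<kappa> r s \<bullet> \<psi> s) u * norm (du (x r) u)
      + (du (x r) u /\<^sub>R norm (du (x r) u)) \<bullet> du \<psi> u) = 0"
  shows "lump N w (x t) (\<lambda>s. dt \<kappa> t s \<bullet> \<psi> s)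
    + (\<Sum>i = 1..<N. edge w (dt x t) i \<bullet> edge w \<psi> i / norm (edge w (x t) i)) = 0"
proof -
  let ?G = "\<lambda>r. lump N w (x r) (\<lambda>s. \<kappa> r s \<bullet> \<psi> s) + (\<Sum>i = 1..<N. sgn (edge w (x r) i) \<bullet> edge w \<psi> i)"
  let ?d = "lump N w (x t) (\<lambda>s. dt \<kappa> t s \<bullet> \<psi> s)
    + (\<Sum>i = 1..<N. edge w (dt x t) i \<bullet> edge w \<psi> i / norm (edge w (x t) i))"
  have "(?G has_real_derivative ?d) (at t)"
  proof (intro DERIV_add DERIV_sum lump_has_real_derivative x reg inext)
    fix i assume "i \<in> {1..N}"
    from inner_has_real_derivative[OF dt_has_vector_derivative[of \<kappa>, OF \<kappa>[OF this]]
        has_vector_derivative_const[of "\<psi> (w i)"]]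
    show "((\<lambda>r. \<kappa> r (w i) \<bullet> \<psi> (w i)) has_real_derivative dt \<kappa> t (w i) \<bullet> \<psi> (w i)) (at t)"
      by simp
  next
    fix i assume i: "i \<in> {1..<N}"
    have "((\<lambda>r. sgn (edge w (x r) i)) has_vector_derivative edge w (dt x t) i /\<^sub>R norm (edge w (x t) i)) (at t)"
      using sgn_has_vector_derivative[OF edge_has_vector_derivative[of x w i t, OF x x] reg[OF i]]
        inext[OF i] i by simp
    from inner_has_real_derivative[OF this has_vector_derivative_const[of "edge w \<psi> i"]]
    show "((\<lambda>r. sgn (edge w (x r) i) \<bullet> edge w \<psi> i) has_real_derivative
        edge w (dt x t) i \<bullet> edge w \<psi> i / norm (edge w (x t) i)) (at t)"
      by (simp add: divide_inverse mult.commute)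
  qed
  moreover have "(?G has_real_derivative 0) (at t)"
    by (rule has_field_derivative_transform_within_open[OF DERIV_const[of 0] S])
      (use eq curvature_equation_nodal[OF m V \<psi>] in simp)
  ultimately show ?thesis by (rule DERIV_unique)
qed

text \<open>The momentum equation tested with the velocity \<open>V\<close>. The projection in the bending force can be
  dropped because \<open>V\<close> is inextensible, which produces the same sum as \<open>curvature_rate\<close>.\<close>

lemma momentum_power:
  fixes K :: "real^3^3"
  assumes m: "is_mesh N w" and V: "X \<in> Vh N w" "V \<in> Vh N w" "Y \<in> Vh N w" "k \<in> Vh N w"
    and z: "z \<in> Qh N w"
    and inext: "\<And>i. i \<in> {1..<N} \<Longrightarrow> sgn (edge w X i) \<bullet> edge w V i = 0"
    and mom: "integral {0..1} (\<lambda>s. ((K *v V s) \<bullet> V s) * norm (du X s))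
      - integral {0..1} (\<lambda>s. p s * (tangent X s \<bullet> du V s))
      - integral {0..1} (\<lambda>s. ((mat 1 - tangent X s \<otimes> tangent X s) *v (du Y s /\<^sub>R norm (du X s))
          + z s *\<^sub>R (tangent X s \<times> k s)) \<bullet> du V s) = 0"
    and pressure: "integral {0..1} (\<lambda>s. p s * (tangent X s \<bullet> du V s)) = 0"
  shows "integral {0..1} (\<lambda>s. ((K *v V s) \<bullet> V s) * norm (du X s))
    = (\<Sum>i = 1..<N. edge w V i \<bullet> edge w Y i / norm (edge w X i))
      + integral {0..1} (\<lambda>s. ((tangent X s \<times> k s) \<bullet> du V s) * z s)"
proof -
  let ?h = "\<lambda>i. w (Suc i) - w i"
  let ?F = "\<lambda>s. ((mat 1 - tangent X s \<otimes> tangent X s) *v (du Y s /\<^sub>R norm (du X s))) \<bullet> du V s"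
  let ?J = "\<lambda>s. ((tangent X s \<times> k s) \<bullet> du V s) * z s"
  have F: "?F s = (edge w V i \<bullet> edge w Y i / norm (edge w X i)) / ?h i"
    if i: "i \<in> {1..<N}" and s: "s \<in> {w i<..<w (Suc i)}" for i s
  proof -
    have "du Y s /\<^sub>R norm (du X s) = edge w Y i /\<^sub>R norm (edge w X i)"
      using mesh_step[OF m i] by (simp add: du_Vh[OF m V(3) i s] norm_du_Vh[OF m V(1) i s] divide_inverse)
    then show ?thesis
      using inext[OF i]
      by (simp add: tangential_projection tangent_Vh[OF m V(1) i s] du_Vh[OF m V(2) i s]
          inner_diff_left inner_diff_right inner_commute divide_inverse)
  qed
  have "(?F has_integral (\<Sum>i = 1..<N. ?h i *\<^sub>R
      ((edge w V i \<bullet> edge w Y i / norm (edge w X i)) / ?h i))) {0..1}"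
    by (rule has_integral_elementwise_const[OF m F])
  moreover have "(\<Sum>i = 1..<N. ?h i *\<^sub>R
        ((edge w V i \<bullet> edge w Y i / norm (edge w X i)) / ?h i))
      = (\<Sum>i = 1..<N. edge w V i \<bullet> edge w Y i / norm (edge w X i))"
    by (rule sum.cong[OF refl]) (use mesh_step[OF m] in fastforce)
  ultimately have intF: "(?F has_integral
      (\<Sum>i = 1..<N. edge w V i \<bullet> edge w Y i / norm (edge w X i))) {0..1}"
    by (simp only:)
  have "?J integrable_on {0..1}"
  proof (rule integrable_elementwise[OF m])
    fix i assume i: "i \<in> {1..<N}"
    have "continuous_on {w i..w (Suc i)} k"
      using V(4) continuous_on_subset[OF _ mesh_element_subset[OF m i]] by (auto simp: Vh_def)
    then show "(\<lambda>s. ((sgn (edge w X i) \<times> k s) \<bullet> (edge w V i /\<^sub>R ?h i)) * z (midpt w i))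
        integrable_on {w i..w (Suc i)}"
      by (intro integrable_continuous_real continuous_intros continuous_on_cross)
  next
    fix i s assume i: "i \<in> {1..<N}" and s: "s \<in> {w i<..<w (Suc i)}"
    show "?J s = ((sgn (edge w X i) \<times> k s) \<bullet> (edge w V i /\<^sub>R ?h i)) * z (midpt w i)"
      using tangent_Vh[OF m V(1) i s] du_Vh[OF m V(2) i s] Qh_on_element[OF m z i s] by simp
  qed
  from has_integral_add[OF intF integrable_integral[OF this]]
  have "integral {0..1} (\<lambda>s. ((mat 1 - tangent X s \<otimes> tangent X s) *v (du Y s /\<^sub>R norm (du X s))
          + z s *\<^sub>R (tangent X s \<times> k s)) \<bullet> du V s)
      = (\<Sum>i = 1..<N. edge w V i \<bullet> edge w Y i / norm (edge w X i)) + integral {0..1} ?J"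
    by (intro integral_unique) (simp add: inner_add_left mult.commute)
  then show ?thesis using mom pressure by simp
qed



section \<open>Twist and the derivative of the energy\<close>

lemma dt_Qh_on_element:
  assumes m: "is_mesh N w" and S: "open S" "t \<in> S" and Q: "\<And>r. r \<in> S \<Longrightarrow> \<gamma> r \<in> Qh N w"
    and diff: "(\<lambda>r. \<gamma> r (midpt w i)) differentiable at t"
    and i: "i \<in> {1..<N}" and s: "s \<in> {w i<..<w (Suc i)}"
  shows "dt \<gamma> t s = dt \<gamma> t (midpt w i)"
proof -
  have "((\<lambda>r. \<gamma> r s) has_vector_derivative dt \<gamma> t (midpt w i)) (at t)"
    by (rule has_vector_derivative_transform_within_open[OF dt_has_vector_derivative[of \<gamma>, OF diff] S])
      (use Qh_on_element[OF m Q i s] in simp)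
  then show ?thesis unfolding dt_def by (rule vector_derivative_at)
qed

lemma integrable_on_element:
  fixes f :: "real \<Rightarrow> real"
  assumes "is_mesh N w" "i \<in> {1..<N}" "f integrable_on {0..1}"
  shows "f integrable_on {w i..w (Suc i)}"
  using integrable_on_subinterval[OF assms(3) mesh_element_subset[OF assms(1,2)]] .

text \<open>The coefficient \<open>C\<close> and the preferred twist \<open>g\<close> are merely integrable. As \<open>\<gamma>\<close> is constant on
  elements, the twist energy is nevertheless a quadratic polynomial in the numbers
  \<open>\<gamma> (midpt w i)\<close> with constant coefficients, so that it can be differentiated in time without
  differentiating under the integral sign.\<close>

lemma has_integral_twist_energy:
  fixes C g \<gamma> :: "real \<Rightarrow> real"
  assumes m: "is_mesh N w" and X: "X \<in> Vh N w" and \<gamma>: "\<gamma> \<in> Qh N w"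
    and int: "C integrable_on {0..1}" "(\<lambda>u. C u * g u) integrable_on {0..1}"
      "(\<lambda>u. C u * (g u)\<^sup>2) integrable_on {0..1}"
  shows "((\<lambda>u. C u * (\<gamma> u - g u)\<^sup>2 * norm (du X u)) has_integral
    (\<Sum>i = 1..<N. norm (edge w X i) *
      (((\<gamma> (midpt w i))\<^sup>2 * integral {w i..w (Suc i)} C
        - 2 * \<gamma> (midpt w i) * integral {w i..w (Suc i)} (\<lambda>u. C u * g u)
        + integral {w i..w (Suc i)} (\<lambda>u. C u * (g u)\<^sup>2)) / (w (Suc i) - w i)))) {0..1}"
proof (rule has_integral_elementwise[OF m])
  fix i assume i: "i \<in> {1..<N}"
  note I = int[THEN integrable_on_element[OF m i], THEN integrable_integral]
  let ?c = "\<gamma> (midpt w i)" and ?e = "norm (edge w X i) / (w (Suc i) - w i)"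
  have "((\<lambda>u. (?c\<^sup>2 * C u - 2 * ?c * (C u * g u) + C u * (g u)\<^sup>2) * ?e) has_integral
      (?c\<^sup>2 * integral {w i..w (Suc i)} C
        - 2 * ?c * integral {w i..w (Suc i)} (\<lambda>u. C u * g u)
        + integral {w i..w (Suc i)} (\<lambda>u. C u * (g u)\<^sup>2)) * ?e) {w i..w (Suc i)}"
    by (intro has_integral_mult_left has_integral_add has_integral_diff has_integral_mult_right I)
  then show "((\<lambda>u. (?c\<^sup>2 * C u - 2 * ?c * (C u * g u) + C u * (g u)\<^sup>2) * ?e) has_integral
      norm (edge w X i) * ((?c\<^sup>2 * integral {w i..w (Suc i)} C
        - 2 * ?c * integral {w i..w (Suc i)} (\<lambda>u. C u * g u)
        + integral {w i..w (Suc i)} (\<lambda>u. C u * (g u)\<^sup>2)) / (w (Suc i) - w i))) {w i..w (Suc i)}"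
    by (simp add: mult.commute)
next
  fix i u assume i: "i \<in> {1..<N}" and u: "u \<in> {w i<..<w (Suc i)}"
  let ?c = "\<gamma> (midpt w i)"
  show "C u * (\<gamma> u - g u)\<^sup>2 * norm (du X u)
      = (?c\<^sup>2 * C u - 2 * ?c * (C u * g u) + C u * (g u)\<^sup>2) * (norm (edge w X i) / (w (Suc i) - w i))"
    unfolding Qh_on_element[OF m \<gamma> i u] norm_du_Vh[OF m X i u]
    by (simp add: power2_diff algebra_simps)
qed

text \<open>This is half the derivative of the quadratic polynomial in
  \<open>has_integral_twist_energy\<close> in the direction \<open>\<gamma>'\<close>.\<close>

lemma has_integral_twist_stress:
  fixes C g \<gamma> \<gamma>' :: "real \<Rightarrow> real"
  assumes m: "is_mesh N w" and X: "X \<in> Vh N w" and \<gamma>: "\<gamma> \<in> Qh N w" "\<gamma>' \<in> Qh N w"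
    and int: "C integrable_on {0..1}" "(\<lambda>u. C u * g u) integrable_on {0..1}"
  shows "((\<lambda>u. C u * (\<gamma> u - g u) * \<gamma>' u * norm (du X u)) has_integral
    (\<Sum>i = 1..<N. norm (edge w X i) *
      (\<gamma>' (midpt w i) * (\<gamma> (midpt w i) * integral {w i..w (Suc i)} C
        - integral {w i..w (Suc i)} (\<lambda>u. C u * g u)) / (w (Suc i) - w i)))) {0..1}"
proof (rule has_integral_elementwise[OF m])
  fix i assume i: "i \<in> {1..<N}"
  note I = int[THEN integrable_on_element[OF m i], THEN integrable_integral]
  let ?c = "\<gamma> (midpt w i)" and ?c' = "\<gamma>' (midpt w i)" and ?e = "norm (edge w X i) / (w (Suc i) - w i)"
  have "((\<lambda>u. ?c' * (?c * C u - C u * g u) * ?e) has_integral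
      ?c' * (?c * integral {w i..w (Suc i)} C - integral {w i..w (Suc i)} (\<lambda>u. C u * g u)) * ?e)
      {w i..w (Suc i)}"
    by (intro has_integral_mult_left has_integral_diff has_integral_mult_right I)
  then show "((\<lambda>u. ?c' * (?c * C u - C u * g u) * ?e) has_integral
      norm (edge w X i) * (?c' * (?c * integral {w i..w (Suc i)} C
        - integral {w i..w (Suc i)} (\<lambda>u. C u * g u)) / (w (Suc i) - w i))) {w i..w (Suc i)}"
    by (simp add: mult.commute)
next
  fix i u assume i: "i \<in> {1..<N}" and u: "u \<in> {w i<..<w (Suc i)}"
  show "C u * (\<gamma> u - g u) * \<gamma>' u * norm (du X u)
      = \<gamma>' (midpt w i) * (\<gamma> (midpt w i) * C u - C u * g u) * (norm (edge w X i) / (w (Suc i) - w i))"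
    unfolding Qh_on_element[OF m \<gamma>(1) i u] Qh_on_element[OF m \<gamma>(2) i u] norm_du_Vh[OF m X i u]
    by (simp add: algebra_simps)
qed

lemma integrable_Qh_product:
  assumes m: "is_mesh N w" and X: "X \<in> Vh N w" and q: "q \<in> Qh N w" "q' \<in> Qh N w"
    and D: "D integrable_on {0..1}"
  shows "(\<lambda>u. D u * (q u * q' u) * norm (du X u)) integrable_on {0..1}"
proof (rule integrable_elementwise[OF m])
  fix i assume i: "i \<in> {1..<N}"
  show "(\<lambda>u. D u * (q (midpt w i) * q' (midpt w i) * (norm (edge w X i) / (w (Suc i) - w i))))
      integrable_on {w i..w (Suc i)}"
    using integrable_on_mult_left[OF integrable_on_element[OF m i D]] .
next
  fix i u assume i: "i \<in> {1..<N}" and u: "u \<in> {w i<..<w (Suc i)}"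
  show "D u * (q u * q' u) * norm (du X u)
      = D u * (q (midpt w i) * q' (midpt w i) * (norm (edge w X i) / (w (Suc i) - w i)))"
    unfolding Qh_on_element[OF m q(1) i u] Qh_on_element[OF m q(2) i u] norm_du_Vh[OF m X i u]
    by simp
qed

text \<open>The constitutive law of the twist tested with the twist rate; integrability of each part is
  what allows the single integral to be split.\<close>

lemma twist_power:
  fixes C D g z \<gamma> \<gamma>' :: "real \<Rightarrow> real"
  assumes m: "is_mesh N w" and X: "X \<in> Vh N w"
    and Q: "z \<in> Qh N w" "\<gamma> \<in> Qh N w" "\<gamma>' \<in> Qh N w"
    and int: "C integrable_on {0..1}" "(\<lambda>u. C u * g u) integrable_on {0..1}" "D integrable_on {0..1}"
    and eq: "integral {0..1} (\<lambda>u. (z u - C u * (\<gamma> u - g u) - D u * \<gamma>' u) * \<gamma>' u * norm (du X u)) = 0"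
  shows "integral {0..1} (\<lambda>u. \<gamma>' u * z u * norm (du X u))
    = integral {0..1} (\<lambda>u. C u * (\<gamma> u - g u) * \<gamma>' u * norm (du X u))
      + integral {0..1} (\<lambda>u. D u * (\<gamma>' u)\<^sup>2 * norm (du X u))"
proof -
  have 1: "(\<lambda>u. \<gamma>' u * z u * norm (du X u)) integrable_on {0..1}"
    using integrable_Qh_product[OF m X Q(3,1), of "\<lambda>_. 1"] by (simp add: integrable_const_ivl)
  have 2: "(\<lambda>u. C u * (\<gamma> u - g u) * \<gamma>' u * norm (du X u)) integrable_on {0..1}"
    using has_integral_twist_stress[OF m X Q(2,3) int(1,2)] by blast
  have 3: "(\<lambda>u. D u * (\<gamma>' u)\<^sup>2 * norm (du X u)) integrable_on {0..1}"
    using integrable_Qh_product[OF m X Q(3,3) int(3)] by (simp add: power2_eq_square)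
  have "integral {0..1} (\<lambda>u. \<gamma>' u * z u * norm (du X u)
      - C u * (\<gamma> u - g u) * \<gamma>' u * norm (du X u) - D u * (\<gamma>' u)\<^sup>2 * norm (du X u))
    = integral {0..1} (\<lambda>u. (z u - C u * (\<gamma> u - g u) - D u * \<gamma>' u) * \<gamma>' u * norm (du X u))"
    by (rule integral_cong) (simp add: algebra_simps power2_eq_square)
  moreover have "integral {0..1} (\<lambda>u. \<gamma>' u * z u * norm (du X u)
      - C u * (\<gamma> u - g u) * \<gamma>' u * norm (du X u) - D u * (\<gamma>' u)\<^sup>2 * norm (du X u))
    = integral {0..1} (\<lambda>u. \<gamma>' u * z u * norm (du X u))
    - integral {0..1} (\<lambda>u. C u * (\<gamma> u - g u) * \<gamma>' u * norm (du X u))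
      - integral {0..1} (\<lambda>u. D u * (\<gamma>' u)\<^sup>2 * norm (du X u))"
    using integral_diff[OF integrable_diff[OF 1 2] 3] integral_diff[OF 1 2] by simp
  ultimately show ?thesis using eq by simp
qed

text \<open>Near \<open>t\<close> the energy is a finite sum of element lengths times quadratic polynomials in
  nodal and element values, once the preferred fields have been frozen at time \<open>t\<close>.\<close>

lemma energy_has_real_derivative:
  fixes x :: "real \<Rightarrow> real \<Rightarrow> real^3" and \<alpha> \<beta> \<gamma> \<alpha>0 \<beta>0 \<gamma>0 :: "real \<Rightarrow> real \<Rightarrow> real"
  assumes m: "is_mesh N w" and S: "open S" "t \<in> S"
    and V: "\<And>r. r \<in> S \<Longrightarrow> x r \<in> Vh N w" and Q: "\<And>r. r \<in> S \<Longrightarrow> \<gamma> r \<in> Qh N w"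
    and x: "\<And>i. i \<in> {1..N} \<Longrightarrow> (\<lambda>r. x r (w i)) differentiable at t"
    and reg: "\<And>i. i \<in> {1..<N} \<Longrightarrow> edge w (x t) i \<noteq> 0"
    and inext: "\<And>i. i \<in> {1..<N} \<Longrightarrow> sgn (edge w (x t) i) \<bullet> edge w (dt x t) i = 0"
    and \<alpha>: "\<And>i. i \<in> {1..N} \<Longrightarrow> ((\<lambda>r. \<alpha> r (w i)) has_real_derivative dt \<alpha> t (w i)) (at t)"
    and \<beta>: "\<And>i. i \<in> {1..N} \<Longrightarrow> ((\<lambda>r. \<beta> r (w i)) has_real_derivative dt \<beta> t (w i)) (at t)"
    and \<gamma>: "\<And>i. i \<in> {1..<N} \<Longrightarrow>
      ((\<lambda>r. \<gamma> r (midpt w i)) has_real_derivative dt \<gamma> t (midpt w i)) (at t)"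
    and \<gamma>': "dt \<gamma> t \<in> Qh N w"
    and int: "C integrable_on {0..1}" "(\<lambda>u. C u * \<gamma>0 t u) integrable_on {0..1}"
      "(\<lambda>u. C u * (\<gamma>0 t u)\<^sup>2) integrable_on {0..1}"
    and indep: "\<And>r u. r \<in> S \<Longrightarrow> u \<in> {0..1} \<Longrightarrow>
      \<alpha>0 r u = \<alpha>0 t u \<and> \<beta>0 r u = \<beta>0 t u \<and> \<gamma>0 r u = \<gamma>0 t u"
  shows "(energy N w A C \<alpha>0 \<beta>0 \<gamma>0 x \<alpha> \<beta> \<gamma> has_real_derivative
    2 * (lump N w (x t) (\<lambda>s. A s * ((\<alpha> t s - \<alpha>0 t s) * dt \<alpha> t s + (\<beta> t s - \<beta>0 t s) * dt \<beta> t s))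
      + integral {0..1} (\<lambda>u. C u * (\<gamma> t u - \<gamma>0 t u) * dt \<gamma> t u * norm (du (x t) u)))) (at t)"
proof -
  let ?b = "\<lambda>r s. A s * ((\<alpha> r s - \<alpha>0 t s)\<^sup>2 + (\<beta> r s - \<beta>0 t s)\<^sup>2)"
  let ?b' = "\<lambda>s. 2 * (A s * ((\<alpha> t s - \<alpha>0 t s) * dt \<alpha> t s + (\<beta> t s - \<beta>0 t s) * dt \<beta> t s))"
  let ?c = "\<lambda>i. integral {w i..w (Suc i)} C"
  let ?d = "\<lambda>i. integral {w i..w (Suc i)} (\<lambda>u. C u * \<gamma>0 t u)"
  let ?e = "\<lambda>i. integral {w i..w (Suc i)} (\<lambda>u. C u * (\<gamma>0 t u)\<^sup>2)"
  let ?g = "\<lambda>r i. \<gamma> r (midpt w i)" and ?g' = "\<lambda>i. dt \<gamma> t (midpt w i)"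
  let ?q = "\<lambda>r i. ((?g r i)\<^sup>2 * ?c i - 2 * ?g r i * ?d i + ?e i) / (w (Suc i) - w i)"
  let ?q' = "\<lambda>i. 2 * (?g' i * (?g t i * ?c i - ?d i) / (w (Suc i) - w i))"
  let ?E = "\<lambda>r. lump N w (x r) (?b r) + (\<Sum>i = 1..<N. norm (edge w (x r) i) * ?q r i)"
  have E: "energy N w A C \<alpha>0 \<beta>0 \<gamma>0 x \<alpha> \<beta> \<gamma> r = ?E r" if r: "r \<in> S" for r
  proof -
    have "((\<lambda>u. interp N w (\<lambda>s. A s * ((\<alpha> r s - \<alpha>0 r s)\<^sup>2 + (\<beta> r s - \<beta>0 r s)\<^sup>2)) u * norm (du (x r) u)
        + C u * (\<gamma> r u - \<gamma>0 t u)\<^sup>2 * norm (du (x r) u)) has_integral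
        lump N w (x r) (\<lambda>s. A s * ((\<alpha> r s - \<alpha>0 r s)\<^sup>2 + (\<beta> r s - \<beta>0 r s)\<^sup>2))
        + (\<Sum>i = 1..<N. norm (edge w (x r) i) * ?q r i)) {0..1}"
      by (intro has_integral_add has_integral_lump[OF m V[OF r]]
          has_integral_twist_energy[OF m V[OF r] Q[OF r] int])
    moreover have "lump N w (x r) (\<lambda>s. A s * ((\<alpha> r s - \<alpha>0 r s)\<^sup>2 + (\<beta> r s - \<beta>0 r s)\<^sup>2))
        = lump N w (x r) (?b r)"
      by (rule lump_cong) (use indep[OF r] mesh_vertex_in[OF m] in simp)
    ultimately show ?thesis
      unfolding energy_def
      by (intro integral_unique, subst has_integral_cong)
        (use indep[OF r] in \<open>simp_all add: algebra_simps\<close>)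
  qed
  have edge: "((\<lambda>r. norm (edge w (x r) i)) has_real_derivative 0) (at t)" if i: "i \<in> {1..<N}" for i
    using norm_has_real_derivative[OF edge_has_vector_derivative[of x w i t, OF x x] reg[OF i]]
      inext[OF i] i by simp
  have "(?E has_real_derivative lump N w (x t) ?b' + (\<Sum>i = 1..<N. norm (edge w (x t) i) * ?q' i)) (at t)"
  proof (intro DERIV_add DERIV_sum lump_has_real_derivative x reg inext)
    fix i assume i: "i \<in> {1..N}"
    show "((\<lambda>r. ?b r (w i)) has_real_derivative ?b' (w i)) (at t)"
      by (rule derivative_eq_intros \<alpha>[OF i] \<beta>[OF i] refl)+ (simp add: algebra_simps)
  next
    fix i assume i: "i \<in> {1..<N}"
    have "((\<lambda>r. (?g r i)\<^sup>2 * ?c i - 2 * ?g r i * ?d i + ?e i) has_real_derivative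
        2 * (?g' i * (?g t i * ?c i - ?d i))) (at t)"
      by (rule derivative_eq_intros \<gamma>[OF i] refl)+ (simp add: algebra_simps)
    from DERIV_cdivide[OF this, of "w (Suc i) - w i"]
    have "((\<lambda>r. ?q r i) has_real_derivative ?q' i) (at t)"
      by simp
    from DERIV_mult[OF edge[OF i] this]
    show "((\<lambda>r. norm (edge w (x r) i) * ?q r i) has_real_derivative norm (edge w (x t) i) * ?q' i) (at t)"
      by (simp add: mult.commute[of _ "norm (edge w (x t) i)"])
  qed
  moreover have "lump N w (x t) ?b' = 2 * lump N w (x t)
      (\<lambda>s. A s * ((\<alpha> t s - \<alpha>0 t s) * dt \<alpha> t s + (\<beta> t s - \<beta>0 t s) * dt \<beta> t s))"
    unfolding lump_def sum_distrib_left by (rule sum.cong[OF refl]) (simp add: algebra_simps)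
  moreover have "(\<Sum>i = 1..<N. norm (edge w (x t) i) * ?q' i)
      = 2 * integral {0..1} (\<lambda>u. C u * (\<gamma> t u - \<gamma>0 t u) * dt \<gamma> t u * norm (du (x t) u))"
    unfolding integral_unique[OF has_integral_twist_stress[OF m V Q \<gamma>' int(1,2), OF S(2) S(2)]]
      sum_distrib_left
    by (rule sum.cong[OF refl]) simp
  ultimately have "(?E has_real_derivative
    2 * (lump N w (x t) (\<lambda>s. A s * ((\<alpha> t s - \<alpha>0 t s) * dt \<alpha> t s + (\<beta> t s - \<beta>0 t s) * dt \<beta> t s))
      + integral {0..1} (\<lambda>u. C u * (\<gamma> t u - \<gamma>0 t u) * dt \<gamma> t u * norm (du (x t) u)))) (at t)"
    by (simp add: distrib_left)
  then show ?thesis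
    by (rule has_field_derivative_transform_within_open[OF _ S]) (use E in simp)
qed


section \<open>The energy identity\<close>

theorem lemma5:
  fixes N :: nat and w :: "nat \<Rightarrow> real" and T Krot A\<^sub>0 C\<^sub>0 :: real and K :: "real^3^3"
    and A B C D :: "real \<Rightarrow> real"
    and \<alpha>0 \<beta>0 \<gamma>0 :: "real \<Rightarrow> real \<Rightarrow> real"
    and x0 e10 e20 :: "real \<Rightarrow> real^3"
    and x y \<kappa> e1 e2 :: "real \<Rightarrow> real \<Rightarrow> real^3"
    and m z \<gamma> p \<alpha> \<beta> :: "real \<Rightarrow> real \<Rightarrow> real"
  assumes mesh: "is_mesh N w"
    and T: "T > 0"
    and K: "pos_def K" and Krot: "Krot > 0"
    and A: "A\<^sub>0 > 0" "\<And>u. u \<in> {0..1} \<Longrightarrow> A u \<ge> A\<^sub>0"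
    and B: "\<And>u. u \<in> {0..1} \<Longrightarrow> B u \<ge> 0"
    and C: "C\<^sub>0 > 0" "\<And>u. u \<in> {0..1} \<Longrightarrow> C u > C\<^sub>0"
    and D: "\<And>u. u \<in> {0..1} \<Longrightarrow> D u \<ge> 0"
    and integrable:
      "C absolutely_integrable_on {0..1}" "D absolutely_integrable_on {0..1}"
      "\<And>t. t \<in> {0..<T} \<Longrightarrow> (\<lambda>u. C u * \<gamma>0 t u) absolutely_integrable_on {0..1}"
      "\<And>t. t \<in> {0..<T} \<Longrightarrow> (\<lambda>u. C u * (\<gamma>0 t u)\<^sup>2) absolutely_integrable_on {0..1}"
    and time_independent:
      "\<And>u t t'. u \<in> {0..1} \<Longrightarrow> t \<in> {0..<T} \<Longrightarrow> t' \<in> {0..<T} \<Longrightarrow>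
         \<alpha>0 t u = \<alpha>0 t' u \<and> \<beta>0 t u = \<beta>0 t' u \<and> \<gamma>0 t u = \<gamma>0 t' u"
    and solution: "semidiscrete_solution N w T K Krot A B C D \<alpha>0 \<beta>0 \<gamma>0 x0 e10 e20 x y \<kappa> m z \<gamma> p e1 e2"
    and components: "curvature_components N w T \<kappa> e1 e2 \<alpha> \<beta>"
    and t: "t \<in> {0<..<T}"
  shows "(\<forall>u\<in>{0..1}. (\<lambda>r. \<alpha> r u) differentiable at t \<and> (\<lambda>r. \<beta> r u) differentiable at t) \<and>
    energy N w A C \<alpha>0 \<beta>0 \<gamma>0 x \<alpha> \<beta> \<gamma> differentiable at t \<and>
    integral {0..1} (\<lambda>u. ((K *v dt x t u) \<bullet> dt x t u
        + interp N w (\<lambda>s. Krot * (m t s)\<^sup>2) u) * norm (du (x t) u))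
    + 1 / 2 * deriv (energy N w A C \<alpha>0 \<beta>0 \<gamma>0 x \<alpha> \<beta> \<gamma>) t
    + integral {0..1} (\<lambda>u. (interp N w (\<lambda>s. B s * ((dt \<alpha> t s)\<^sup>2 + (dt \<beta> t s)\<^sup>2)) u
        + D u * (dt \<gamma> t u)\<^sup>2) * norm (du (x t) u)) = 0"
proof -
  let ?S = "{0<..<T}"
  have S: "open ?S" "t \<in> ?S" and St: "\<And>r. r \<in> ?S \<Longrightarrow> r \<in> {0..<T}" using t by auto
  have N: "N \<ge> 2" "w 1 = 0" "w N = 1" using mesh by (auto simp: is_mesh_def)
  note node01 = mesh_vertex_in[OF mesh]
  have ok: "fields_ok N w T \<alpha>0 \<beta>0 x y \<kappa> m z \<gamma> p e1 e2"
    and data: "initial_data N w x0 e10 e20"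
    and init: "initial_equations N w x0 e10 e20 x \<kappa> \<gamma> e1 e2"
    and eqs: "\<And>r. r \<in> ?S \<Longrightarrow>
      semidiscrete_equations N w K Krot A B C D \<alpha>0 \<beta>0 \<gamma>0 x y \<kappa> m z \<gamma> p e1 e2 r"
    using solution by (auto simp: semidiscrete_solution_def)
  have V: "x r \<in> Vh N w" "y r \<in> Vh0 N w" "\<kappa> r \<in> Vh N w" "m r \<in> Vh N w"
      "e1 r \<in> Vh N w" "e2 r \<in> Vh N w"
    and Q: "z r \<in> Qh N w" "\<gamma> r \<in> Qh N w" "p r \<in> Qh N w"
    and bc: "\<forall>s\<in>{0, 1}. \<kappa> r s = \<alpha>0 r s *\<^sub>R e1 r s + \<beta>0 r s *\<^sub>R e2 r s"
    and reg: "regular_curve N w (x r)" if "r \<in> {0..<T}" for r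
    using ok that unfolding fields_ok_def by blast+
  have VS: "x r \<in> Vh N w" "\<gamma> r \<in> Qh N w" "\<alpha> r \<in> Vh N w" "\<beta> r \<in> Vh N w" if "r \<in> ?S" for r
    using V Q St[OF that] components that by (auto simp: curvature_components_def)
  have cont: "continuous_on {0..<T} (\<lambda>r. x r (w i))" "continuous_on {0..<T} (\<lambda>r. e1 r (w i))"
      "continuous_on {0..<T} (\<lambda>r. e2 r (w i))" if "i \<in> {1..N}" for i
    using ok node01[OF that] unfolding fields_ok_def by blast+
  have diff: "(\<lambda>r. x r (w i)) differentiable at r" "(\<lambda>r. \<kappa> r (w i)) differentiable at r"
      "(\<lambda>r. e1 r (w i)) differentiable at r" "(\<lambda>r. e2 r (w i)) differentiable at r"
    if "i \<in> {1..N}" "r \<in> ?S" for i r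
    using ok node01[OF that(1)] that(2) unfolding fields_ok_def by blast+
  have diff\<gamma>: "(\<lambda>r. \<gamma> r (midpt w i)) differentiable at t" if "i \<in> {1..<N}" for i
    using ok midpt_in[OF mesh that] that t unfolding fields_ok_def by blast
  have \<gamma>': "dt \<gamma> t \<in> Qh N w"
    by (rule QhI) (rule dt_Qh_on_element[OF mesh S VS(2) diff\<gamma>])
  have x': "dt x t \<in> Vh N w"
    by (rule dt_in_Vh[OF mesh S VS(1) diff(1)]) (use t in auto)
  have edge_nz: "edge w (x t) i \<noteq> 0" if "i \<in> {1..<N}" for i
    using regular_curve_edge[OF mesh V(1) reg that] t by auto
  have yV: "y t \<in> Vh N w" "y t 0 = 0" "y t 1 = 0" using V(2)[of t] t by (auto simp: Vh0_def)

  let ?\<tau> = "tangent (x t)" and ?speed = "\<lambda>s. norm (du (x t) s)"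
  let ?\<theta> = "\<lambda>r. vertex_tangent N w (x r)"
  let ?\<theta>' = "\<lambda>r. dt (\<lambda>r. vertex_tangent N w (x r)) r"
  note eq = eqs[OF t, unfolded semidiscrete_equations_def Let_def]
  have eq1: "integral {0..1} (\<lambda>s. ((K *v dt x t s) \<bullet> \<phi> s) * ?speed s)
         - integral {0..1} (\<lambda>s. p t s * (?\<tau> s \<bullet> du \<phi> s))
         - integral {0..1} (\<lambda>s. ((mat 1 - ?\<tau> s \<otimes> ?\<tau> s) *v (du (y t) s /\<^sub>R ?speed s)
             + z t s *\<^sub>R (?\<tau> s \<times> \<kappa> t s)) \<bullet> du \<phi> s) = 0" if "\<phi> \<in> Vh N w" for \<phi>
    using eq that by blast
  have eq2: "integral {0..1} (\<lambda>u. interp N w (\<lambda>s.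
             (y t s - A s *\<^sub>R (\<kappa> t s - \<alpha>0 t s *\<^sub>R e1 t s - \<beta>0 t s *\<^sub>R e2 t s)
              - B s *\<^sub>R ((mat 1 - ?\<theta> t s \<otimes> ?\<theta> t s) *v dt \<kappa> t s
                - m t s *\<^sub>R (?\<theta> t s \<times> \<kappa> t s))) \<bullet> \<psi> s) u * ?speed u) = 0"
    if "\<psi> \<in> Vh0 N w" for \<psi>
    using eq that by blast
  have eq3: "integral {0..1} (\<lambda>u. interp N w (\<lambda>s. \<kappa> r s \<bullet> \<psi> s) u * norm (du (x r) u)
      + (du (x r) u /\<^sub>R norm (du (x r) u)) \<bullet> du \<psi> u) = 0"
    if "\<psi> \<in> Vh0 N w" "r \<in> ?S" for \<psi> r
    using eqs[OF that(2)] that(1) unfolding semidiscrete_equations_def Let_def by blast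
  have eq4: "- integral {0..1} (\<lambda>u. interp N w (\<lambda>s. Krot * m t s * v s) u * ?speed u)
         - integral {0..1} (\<lambda>u. z t u * du v u)
         + integral {0..1} (\<lambda>u. interp N w (\<lambda>s. (y t s \<bullet> (?\<theta> t s \<times> \<kappa> t s)) * v s) u * ?speed u) = 0"
    if "v \<in> Vh N w" for v
    using eq that by blast
  have eq5: "integral {0..1} (\<lambda>s. (z t s - C s * (\<gamma> t s - \<gamma>0 t s) - D s * dt \<gamma> t s) * q s * ?speed s) = 0"
    if "q \<in> Qh N w" for q
    using eq that by blast
  have eq6: "integral {0..1} (\<lambda>s. dt \<gamma> t s * q s * ?speed s)
         - integral {0..1} (\<lambda>s. du (m t) s * q s)
         + integral {0..1} (\<lambda>s. ((?\<tau> s \<times> \<kappa> t s) \<bullet> du (dt x t) s) * q s) = 0" if "q \<in> Qh N w" for q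
    using eq that by blast
  have eq7: "integral {0..1} (\<lambda>s. q s * (?\<tau> s \<bullet> du (dt x t) s)) = 0" if "q \<in> Qh N w" for q
    using eq that by blast
  have eq8: "integral {0..1} (\<lambda>u. interp N w (\<lambda>s.
             (dt e r s - (?\<theta> r s \<times> ?\<theta>' r s + m r s *\<^sub>R ?\<theta> r s) \<times> e r s) \<bullet> \<phi> s) u
             * norm (du (x r) u)) = 0"
    if "\<phi> \<in> Vh N w" "r \<in> ?S" "e \<in> {e1, e2}" for \<phi> r e
    using eqs[OF that(2)] that(1,3) unfolding semidiscrete_equations_def Let_def by blast

  have inext: "sgn (edge w (x t) i) \<bullet> edge w (dt x t) i = 0" if "i \<in> {1..<N}" for i
    using inextensible_edges[OF mesh VS(1)[OF t] x' eq7 that] .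

  have frame_eq: "dt e r (w i) = (?\<theta> r (w i) \<times> ?\<theta>' r (w i) + m r (w i) *\<^sub>R ?\<theta> r (w i)) \<times> e r (w i)"
    if i: "i \<in> {1..N}" and r: "r \<in> ?S" and e: "e \<in> {e1, e2}" for i r e
  proof -
    let ?g = "\<lambda>s. dt e r s - (?\<theta> r s \<times> ?\<theta>' r s + m r s *\<^sub>R ?\<theta> r s) \<times> e r s"
    have "lump N w (x r) (\<lambda>s. ?g s \<bullet> spike N w i (?g (w i)) s) = 0"
      using eq8[OF spike_Vh[OF mesh] r e] integral_unique[OF has_integral_lump[OF mesh VS(1)[OF r]]]
      by metis
    from lump_spike_eq_0[OF mesh i _ this] regular_curve_edge[OF mesh VS(1)[OF r] reg[OF St[OF r]]]
    show ?thesis by simp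
  qed
  have \<theta>_diff: "(\<lambda>r. ?\<theta> r (w i)) differentiable at r" if i: "i \<in> {1..N}" and r: "r \<in> ?S" for i r
    by (rule vertex_tangent_differentiable[OF mesh S(1) r VS(1) diff(1)[OF _ r] reg[OF St[OF r]] i])
  have unit: "norm (?\<theta> r (w i)) = 1" if i: "i \<in> {1..N}" and r: "r \<in> {0..<T}" for i r
    using vertex_tangent_node[OF mesh V(1)[OF r] i] regular_curve_tangent_sum[OF mesh V(1)[OF r] reg[OF r] i]
    by (simp add: norm_sgn)
  have frame: "orthonormal3 (?\<theta> r (w i)) (e1 r (w i)) (e2 r (w i))"
    if i: "i \<in> {1..N}" and r: "r \<in> ?S" for i r
  proof (rule frame_orthonormal[OF _ unit[OF i] _ _ _ cont(2,3)[OF i] _ r])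
    show "((\<lambda>r. ?\<theta> r (w i)) has_vector_derivative ?\<theta>' r (w i)) (at r)" if "r \<in> ?S" for r
      by (rule dt_has_vector_derivative) (rule \<theta>_diff[OF i that])
    show "((\<lambda>r. e1 r (w i)) has_vector_derivative
        (?\<theta> r (w i) \<times> ?\<theta>' r (w i) + m r (w i) *\<^sub>R ?\<theta> r (w i)) \<times> e1 r (w i)) (at r)" if "r \<in> ?S" for r
      using dt_has_vector_derivative[of e1, OF diff(3)[OF i that]] frame_eq[OF i that, of e1] by simp
    show "((\<lambda>r. e2 r (w i)) has_vector_derivative
        (?\<theta> r (w i) \<times> ?\<theta>' r (w i) + m r (w i) *\<^sub>R ?\<theta> r (w i)) \<times> e2 r (w i)) (at r)" if "r \<in> ?S" for r
      using dt_has_vector_derivative[of e2, OF diff(4)[OF i that]] frame_eq[OF i that, of e2] by simp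
    show "continuous_on {0..<T} (\<lambda>r. ?\<theta> r (w i))"
      by (rule vertex_tangent_continuous_on[OF mesh V(1) cont(1) reg i])
    \<comment> \<open>The initial tangent is built from \<open>x0\<close>, which agrees with \<open>x 0\<close> on \<open>{0..1}\<close> only; vertex
      tangents depend on nothing but the edges.\<close>
    have x0: "x0 \<in> Vh N w" and on0: "orthonormal3 (vertex_tangent N w x0 (w i)) (e10 (w i)) (e20 (w i))"
      using data i by (auto simp: initial_data_def)
    have same: "x 0 s = x0 s" "e1 0 s = e10 s" "e2 0 s = e20 s" if "s \<in> {0..1}" for s
      using init that by (auto simp: initial_equations_def)
    have "edge w (x 0) j = edge w x0 j" if "j \<in> {1..<N}" for j
      using same(1)[OF node01[of j]] same(1)[OF node01[of "Suc j"]] that by (simp add: edge_def)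
    moreover have "i \<noteq> 1 \<Longrightarrow> i - 1 \<in> {1..<N}" "i \<noteq> N \<Longrightarrow> i \<in> {1..<N}" using i by auto
    ultimately have "tangent_sum N w (x 0) i = tangent_sum N w x0 i"
      unfolding tangent_sum_def by presburger
    then have "?\<theta> 0 (w i) = vertex_tangent N w x0 (w i)"
      using vertex_tangent_node[OF mesh V(1) i, of 0] vertex_tangent_node[OF mesh x0 i] T by simp
    then show "orthonormal3 (?\<theta> 0 (w i)) (e1 0 (w i)) (e2 0 (w i))"
      using on0 same(2,3)[OF node01[OF i]] by simp
  qed

  have comp: "\<kappa> r (w i) = \<alpha> r (w i) *\<^sub>R e1 r (w i) + \<beta> r (w i) *\<^sub>R e2 r (w i)"
    if "i \<in> {1..N}" "r \<in> ?S" for i r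
    using components that by (simp add: curvature_components_def)
  have coeff: "a = v \<bullet> f" "b = v \<bullet> g"
    if "orthonormal3 d f g" "v = a *\<^sub>R f + b *\<^sub>R g" for a b v d f g
    using that by (simp_all add: orthonormal3_def norm_eq_1 inner_add_left inner_commute[of g f])
  have \<alpha>_diff: "(\<lambda>r. \<alpha> r (w i)) differentiable at t" and \<beta>_diff: "(\<lambda>r. \<beta> r (w i)) differentiable at t"
    if i: "i \<in> {1..N}" for i
  proof -
    note \<kappa>d = dt_has_vector_derivative[of \<kappa>, OF diff(2)[OF i t]]
    have "((\<lambda>r. \<alpha> r (w i)) has_real_derivative
        \<kappa> t (w i) \<bullet> dt e1 t (w i) + dt \<kappa> t (w i) \<bullet> e1 t (w i)) (at t)"
      by (rule has_field_derivative_transform_within_open[OF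
          inner_has_real_derivative[OF \<kappa>d dt_has_vector_derivative[of e1, OF diff(3)[OF i t]]] S])
        (simp add: coeff(1)[OF frame[OF i] comp[OF i]])
    then show "(\<lambda>r. \<alpha> r (w i)) differentiable at t"
      using real_differentiable_def by blast
    have "((\<lambda>r. \<beta> r (w i)) has_real_derivative
        \<kappa> t (w i) \<bullet> dt e2 t (w i) + dt \<kappa> t (w i) \<bullet> e2 t (w i)) (at t)"
      by (rule has_field_derivative_transform_within_open[OF
          inner_has_real_derivative[OF \<kappa>d dt_has_vector_derivative[of e2, OF diff(4)[OF i t]]] S])
        (simp add: coeff(2)[OF frame[OF i] comp[OF i]])
    then show "(\<lambda>r. \<beta> r (w i)) differentiable at t"
      using real_differentiable_def by blast
  qed
  have smooth: "(\<lambda>r. \<alpha> r u) differentiable at t" "(\<lambda>r. \<beta> r u) differentiable at t"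
    if u: "u \<in> {0..1}" for u
    using differentiableI_vector[OF Vh_time_derivative[OF mesh S VS(3) \<alpha>_diff u]]
      differentiableI_vector[OF Vh_time_derivative[OF mesh S VS(4) \<beta>_diff u]] by auto

  have deriv: "((\<lambda>r. f r s) has_real_derivative dt f t s) (at t)"
    if "(\<lambda>r. f r s) differentiable at t" for f :: "real \<Rightarrow> real \<Rightarrow> real" and s
    using dt_has_vector_derivative[of f, OF that] by (simp add: has_real_derivative_iff_has_vector_derivative)

  let ?a = "\<lambda>s. A s * ((\<alpha> t s - \<alpha>0 t s) * dt \<alpha> t s + (\<beta> t s - \<beta>0 t s) * dt \<beta> t s)"
  let ?b = "\<lambda>s. B s * ((dt \<alpha> t s)\<^sup>2 + (dt \<beta> t s)\<^sup>2)"
  have vertex: "dt \<kappa> t (w i) \<bullet> y t (w i) - (y t (w i) \<bullet> (?\<theta> t (w i) \<times> \<kappa> t (w i))) * m t (w i)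
      = ?a (w i) + ?b (w i)" if i: "i \<in> {1..N}" for i
  proof (cases "i \<in> {1<..<N}")
    case True
    let ?g = "\<lambda>s. y t s - A s *\<^sub>R (\<kappa> t s - \<alpha>0 t s *\<^sub>R e1 t s - \<beta>0 t s *\<^sub>R e2 t s)
        - B s *\<^sub>R ((mat 1 - ?\<theta> t s \<otimes> ?\<theta> t s) *v dt \<kappa> t s - m t s *\<^sub>R (?\<theta> t s \<times> \<kappa> t s))"
    have "lump N w (x t) (\<lambda>s. ?g s \<bullet> spike N w i (?g (w i)) s) = 0"
      using eq2[OF spike_Vh0[OF mesh True]] integral_unique[OF has_integral_lump[OF mesh VS(1)[OF t]]]
      by metis
    from lump_spike_eq_0[OF mesh i edge_nz this]
    have y: "y t (w i) = A (w i) *\<^sub>R (\<kappa> t (w i) - \<alpha>0 t (w i) *\<^sub>R e1 t (w i) - \<beta>0 t (w i) *\<^sub>R e2 t (w i))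
        + B (w i) *\<^sub>R ((mat 1 - ?\<theta> t (w i) \<otimes> ?\<theta> t (w i)) *v dt \<kappa> t (w i)
          - m t (w i) *\<^sub>R (?\<theta> t (w i) \<times> \<kappa> t (w i)))"
      by (simp add: algebra_simps)
    have "((\<lambda>r. \<alpha> r (w i) *\<^sub>R e1 r (w i) + \<beta> r (w i) *\<^sub>R e2 r (w i)) has_vector_derivative
        (\<alpha> t (w i) *\<^sub>R dt e1 t (w i) + dt \<alpha> t (w i) *\<^sub>R e1 t (w i))
        + (\<beta> t (w i) *\<^sub>R dt e2 t (w i) + dt \<beta> t (w i) *\<^sub>R e2 t (w i))) (at t)"
      by (intro has_vector_derivative_add has_vector_derivative_scaleR deriv \<alpha>_diff \<beta>_diff i
          dt_has_vector_derivative diff t)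
    then have "((\<lambda>r. \<kappa> r (w i)) has_vector_derivative
        (\<alpha> t (w i) *\<^sub>R dt e1 t (w i) + dt \<alpha> t (w i) *\<^sub>R e1 t (w i))
        + (\<beta> t (w i) *\<^sub>R dt e2 t (w i) + dt \<beta> t (w i) *\<^sub>R e2 t (w i))) (at t)"
      by (rule has_vector_derivative_transform_within_open[OF _ S]) (simp add: comp[OF i])
    from vector_derivative_at[OF this]
    have "dt \<kappa> t (w i) = dt \<alpha> t (w i) *\<^sub>R e1 t (w i) + dt \<beta> t (w i) *\<^sub>R e2 t (w i)
        + \<alpha> t (w i) *\<^sub>R dt e1 t (w i) + \<beta> t (w i) *\<^sub>R dt e2 t (w i)"
      unfolding dt_def[of \<kappa>] by simp
    from curvature_power[OF frame[OF i t] comp[OF i t] frame_eq[OF i t, of e1] frame_eq[OF i t, of e2]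
        this y]
    show ?thesis by (simp add: inner_diff_right inner_commute mult.commute)
  next
    case False
    then have ends: "w i \<in> {0, 1}" using i N by (cases "i = 1") auto
    then have y0: "y t (w i) = 0" using yV by auto
    \<comment> \<open>The law for \<open>y\<close> says nothing here, as its test functions vanish at the ends. Both sides are
      \<open>0\<close> because the boundary condition fixes the components.\<close>
    have \<alpha>: "\<alpha> r (w i) = \<alpha>0 t (w i)" and \<beta>: "\<beta> r (w i) = \<beta>0 t (w i)" if r: "r \<in> ?S" for r
    proof -
      have \<kappa>: "\<kappa> r (w i) = \<alpha>0 r (w i) *\<^sub>R e1 r (w i) + \<beta>0 r (w i) *\<^sub>R e2 r (w i)"
        using bc[OF St[OF r]] ends by blast
      show "\<alpha> r (w i) = \<alpha>0 t (w i)" "\<beta> r (w i) = \<beta>0 t (w i)"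
        using coeff[OF frame[OF i r] comp[OF i r]] coeff[OF frame[OF i r] \<kappa>]
          time_independent[OF node01[OF i] St[OF r] St[OF t]] by auto
    qed
    have "((\<lambda>r. \<alpha> r (w i)) has_real_derivative 0) (at t)"
      by (rule has_field_derivative_transform_within_open[OF DERIV_const S]) (simp add: \<alpha>)
    then have "dt \<alpha> t (w i) = 0" using deriv[of \<alpha>, OF \<alpha>_diff[OF i]] DERIV_unique by blast
    moreover have "((\<lambda>r. \<beta> r (w i)) has_real_derivative 0) (at t)"
      by (rule has_field_derivative_transform_within_open[OF DERIV_const S]) (simp add: \<beta>)
    then have "dt \<beta> t (w i) = 0" using deriv[of \<beta>, OF \<beta>_diff[OF i]] DERIV_unique by blast
    ultimately show ?thesis by (simp add: y0)
  qed

  have int: "C integrable_on {0..1}" "(\<lambda>u. C u * \<gamma>0 t u) integrable_on {0..1}"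
      "(\<lambda>u. C u * (\<gamma>0 t u)\<^sup>2) integrable_on {0..1}" "D integrable_on {0..1}"
    using integrable t by (auto simp: absolutely_integrable_on_def)
  note lumped = has_integral_lump[OF mesh VS(1)[OF t]]

  let ?IK = "integral {0..1} (\<lambda>s. ((K *v dt x t s) \<bullet> dt x t s) * ?speed s)"
  let ?P = "\<Sum>i = 1..<N. edge w (dt x t) i \<bullet> edge w (y t) i / norm (edge w (x t) i)"
  let ?J = "integral {0..1} (\<lambda>s. ((?\<tau> s \<times> \<kappa> t s) \<bullet> du (dt x t) s) * z t s)"
  let ?M = "integral {0..1} (\<lambda>s. du (m t) s * z t s)"
  let ?G = "integral {0..1} (\<lambda>s. dt \<gamma> t s * z t s * ?speed s)"
  let ?Q1 = "integral {0..1} (\<lambda>u. C u * (\<gamma> t u - \<gamma>0 t u) * dt \<gamma> t u * ?speed u)"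
  let ?Q2 = "integral {0..1} (\<lambda>u. D u * (dt \<gamma> t u)\<^sup>2 * ?speed u)"
  let ?R = "lump N w (x t) (\<lambda>s. Krot * (m t s)\<^sup>2)"
  let ?Y = "lump N w (x t) (\<lambda>s. (y t s \<bullet> (?\<theta> t s \<times> \<kappa> t s)) * m t s)"
  let ?Z = "lump N w (x t) (\<lambda>s. dt \<kappa> t s \<bullet> y t s)"

  \<comment> \<open>The exchange terms \<open>?P\<close>, \<open>?J\<close>, \<open>?M\<close>, \<open>?G\<close>, \<open>?Y\<close> and \<open>?Z\<close> each occur in two of the following
    six equalities and cancel when these are combined.\<close>
  have momentum: "?IK = ?P + ?J"
    by (rule momentum_power[OF mesh VS(1)[OF t] x' yV(1) V(3)[OF St[OF t]] Q(1)[OF St[OF t]]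
          inext eq1[OF x'] eq7[OF Q(3)[OF St[OF t]]]])
  have curvature: "?Z + ?P = 0"
    by (rule curvature_rate[OF mesh S VS(1) yV(1) diff(1)[OF _ t] diff(2)[OF _ t] edge_nz inext
          eq3[OF V(2)[OF St[OF t]]]])
  have moment: "- ?R - ?M + ?Y = 0"
    using eq4[OF V(4)[OF St[OF t]]] unfolding integral_unique[OF lumped]
    by (simp add: power2_eq_square mult.assoc mult.commute[of "z t _"])
  have torsion: "?G - ?M + ?J = 0"
    by (rule eq6[OF Q(1)[OF St[OF t]]])
  have twist: "?G = ?Q1 + ?Q2"
    by (rule twist_power[OF mesh VS(1)[OF t] Q(1,2)[OF St[OF t]] \<gamma>' int(1,2,4) eq5[OF \<gamma>']])
  have bending: "?Z - ?Y = lump N w (x t) ?a + lump N w (x t) ?b"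
    unfolding lump_diff[symmetric] lump_add[symmetric] by (rule lump_cong) (rule vertex)

  have energy: "(energy N w A C \<alpha>0 \<beta>0 \<gamma>0 x \<alpha> \<beta> \<gamma> has_real_derivative
      2 * (lump N w (x t) ?a + ?Q1)) (at t)"
    by (rule energy_has_real_derivative[where x = x and \<alpha> = \<alpha> and \<beta> = \<beta>
          and \<gamma> = \<gamma> and ?\<gamma>0.0 = \<gamma>0, OF mesh S VS(1,2) diff(1)[OF _ t] edge_nz inext
          deriv[of \<alpha>, OF \<alpha>_diff] deriv[of \<beta>, OF \<beta>_diff] deriv[of \<gamma>, OF diff\<gamma>] \<gamma>' int(1,2,3)])
      (use time_independent[OF _ St St[OF t]] in auto)

  have "(\<lambda>u. ((K *v dt x t u) \<bullet> dt x t u) * ?speed u) integrable_on {0..1}"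
  proof (rule integrable_elementwise[OF mesh])
    fix i assume i: "i \<in> {1..<N}"
    have "continuous_on {w i..w (Suc i)} (dt x t)"
      using x' continuous_on_subset[OF _ mesh_element_subset[OF mesh i]] by (auto simp: Vh_def)
    then show "(\<lambda>u. ((K *v dt x t u) \<bullet> dt x t u) * (norm (edge w (x t) i) / (w (Suc i) - w i)))
        integrable_on {w i..w (Suc i)}"
      by (intro integrable_continuous_real continuous_intros
          bounded_linear.continuous_on[OF matrix_vector_mul_bounded_linear])
  qed (simp add: norm_du_Vh[OF mesh VS(1)[OF t]])
  from has_integral_add[OF integrable_integral[OF this] lumped[of "\<lambda>s. Krot * (m t s)\<^sup>2"]]
  have total1: "integral {0..1} (\<lambda>u. ((K *v dt x t u) \<bullet> dt x t u
        + interp N w (\<lambda>s. Krot * (m t s)\<^sup>2) u) * ?speed u) = ?IK + ?R"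
    by (intro integral_unique) (simp add: distrib_right)
  have "(\<lambda>u. D u * (dt \<gamma> t u)\<^sup>2 * ?speed u) integrable_on {0..1}"
    using integrable_Qh_product[OF mesh VS(1)[OF t] \<gamma>' \<gamma>' int(4)] by (simp add: power2_eq_square)
  from has_integral_add[OF lumped[of ?b] integrable_integral[OF this]]
  have total2: "integral {0..1} (\<lambda>u. (interp N w ?b u + D u * (dt \<gamma> t u)\<^sup>2) * ?speed u)
      = lump N w (x t) ?b + ?Q2"
    by (intro integral_unique) (simp add: distrib_right)
  have half: "1 / 2 * deriv (energy N w A C \<alpha>0 \<beta>0 \<gamma>0 x \<alpha> \<beta> \<gamma>) t = lump N w (x t) ?a + ?Q1"
  proof -
    have "1 / 2 * (2 * r) = r" for r :: real by simp
    then show ?thesis by (simp only: DERIV_imp_deriv[OF energy])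
  qed
  have "?IK + ?R + (lump N w (x t) ?a + ?Q1) + (lump N w (x t) ?b + ?Q2) = 0"
    using momentum curvature moment torsion twist bending by linarith
  then show ?thesis
    unfolding total1 total2 half
    using smooth energy real_differentiable_def by blast
qed

end
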